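(* Let $(V,e)$ be an absolute matrix order unit space satisfying condition (T). Put $K_0(V)^+=\{[(p,0)]:p\in\mathcal{OP}_\infty(V)\}$. Then: (a) $K_0(V)^+$ is a group cone in $K_0(V)$. (b) If $e^n$ is finite for all $n\in\mathbb N$, then $K_0(V)^+$ is proper. (c) $K_0(V)^+$ is generating. In other words, if $e^n$ is finite for all $n\in\mathbb N$, then $(K_0(V),K_0(V)^+)$ is an ordered abelian group (with proper and generating cone).
   Context: **Absolute matrix order unit spaces.** $M_{m,n}(V)$ denotes $m\times n$ matrices over $V$, $M_{m,n}=M_{m,n}(\mathbb C)$ with operator norm, $v\oplus w$ is the block diagonal matrix, $0_n$ the zero of $M_n(V)$. A matrix ordered space is a complex vector space $V$ with involution (with $[v_{ij}]^*=[v_{ji}^*]$ on matrices) and cones $M_n(V)^+\subset M_n(V)_{sa}$ such that each $(M_n(V)_{sa},M_n(V)^+)$ is a real ordered vector space and $a^*va\in M_m(V)^+$ for $v\in M_n(V)^+$, $a\in M_{n,m}$. It is a matrix order unit space with order unit $e\in V^+$ if $e$ is an order unit for $V_{sa}$, $V^+$ is proper and every $M_n(V)^+$ is Archimedean (if $u\in M_n(V)^+$, $v\in M_n(V)_{sa}$ and $ku+v\in M_n(V)^+$ for all $k>0$, then $v\in M_n(V)^+$). Put $e^n=e\oplus\cdots\oplus e\in M_n(V)$ and $\|v\|_n=\inf\left\{k>0:\begin{bmatrix} ke^n & v \\ v^* & ke^n \end{bmatrix}\in M_{2n}(V)^+\right\}$. An absolutely ordered space $(X,X^+,|\cdot|)$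 is a real ordered vector space with $|\cdot|:X\to X^+$ such that: $|v|=v$ for $v\in X^+$; $|v|\pm v\in X^+$; $|kv|=|k||v|$ for $k\in\mathbb R$; if $|u-v|=u+v$ and $0\le w\le v$ then $|u-w|=u+w$; if $|u-v|=u+v$ and $|u-w|=u+w$ then $\big|u-|v\pm w|\big|=u+|v\pm w|$. For $u,v\in X^+$ write $u\perp v$ if $|u-v|=u+v$. An absolute matrix order unit space is a matrix order unit space $(V,\{M_n(V)^+\},e)$ with maps $|\cdot|_{m,n}:M_{m,n}(V)\to M_n(V)^+$ ($|\cdot|_n:=|\cdot|_{n,n}$) such that: (1) each $(M_n(V)_{sa},M_n(V)^+,|\cdot|_n)$ is an absolutely ordered space; (2) $|\alpha v\beta|_{r,s}\le\|\alpha\|\,\big||v|_{m,n}\beta\big|_{n,s}$ for $v\in M_{m,n}(V)$, $\alpha\in M_{r,m}$, $\beta\in M_{n,s}$; (3) $|v\oplus w|_{m+r,n+s}=|v|_{m,n}\oplus|w|_{r,s}$; (4) $\perp=\perp^a_\infty$ on each $M_n(V)^+$, where $u\perp_\infty v$ means $\|k_1u+k_2v\|_n=\max\{\|k_1u\|_n,\|k_2v\|_n\}$ for all $k_1,k_2\in\mathbb R$, and $u\perp^a_\infty v$ means $u_1\perp_\infty v_1$ whenever $0\le u_1\le u$, $0\le v_1\le v$. **Projections and equivalence.** $p\in M_n(V)$ is an order projection if $p^*=p$ and $|2p-e^n|_n=e^n$; $\mathcal{OP}_n(V)$ is the set of these, and $\mathcal{OP}_\infty(V)=\bigcup_n\mathcal{OP}_n(V)$.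 $v\in M_{m,n}(V)$ is a partial isometry ($v\in\mathcal{PI}_{m,n}(V)$) if $|v|_{m,n}$ and $|v^*|_{n,m}$ are order projections. For $p\in\mathcal{OP}_m(V)$, $q\in\mathcal{OP}_n(V)$, $p\sim q$ means there is $v\in\mathcal{PI}_{m,n}(V)$ with $p=|v^*|_{n,m}$ and $q=|v|_{m,n}$. For $p,q\in\mathcal{OP}_\infty(V)$, $p\approx q$ means $p\oplus r\sim q\oplus r$ for some $r\in\mathcal{OP}_\infty(V)$. An order projection $p\in\mathcal{OP}_n(V)$ is finite if $q\in\mathcal{OP}_n(V)$, $q\le p$ and $q\sim p$ imply $q=p$. **Condition (T):** if $u\in\mathcal{PI}_{m,n}(V)$, $v\in\mathcal{PI}_{l,n}(V)$ and $|u|_{m,n}=|v|_{l,n}$, then there is $w\in\mathcal{PI}_{m,l}(V)$ with $|w^*|_{l,m}=|u^*|_{n,m}$ and $|w|_{m,l}=|v^*|_{n,l}$. **$K_0(V)$** (for $V$ satisfying (T)): the abelian group of equivalence classes $[(p,q)]$ of pairs in $\mathcal{OP}_\infty(V)\times\mathcal{OP}_\infty(V)$ under $(p_1,q_1)\equiv(p_2,q_2)\iff p_1\oplus q_2\approx p_2\oplus q_1$, with $[(p_1,q_1)]+[(p_2,q_2)]=[(p_1\oplus p_2,q_1\oplus q_2)]$, identity $[(0,0)]$ and $-[(p,q)]=[(q,p)]$. **Ordered groups.** For an abelian group $G$, a subset $G^+$ is a group cone if $0\in G^+$ and $G^++G^+\subset G^+$; it is proper if $G^+\cap(-G^+)=\{0\}$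 and generating if $G=G^+-G^+$. An ordered abelian group is a pair $(G,G^+)$ with $G^+$ a group cone, which the paper moreover takes to be proper and generating. *)

theory Defs
  imports
    Complex_Main
    "HOL-Analysis.L2_Norm"
    "HOL-Algebra.Group"
    "Jordan_Normal_Form.Matrix"
    "Jordan_Normal_Form.Schur_Decomposition"
begin

section \<open>Ordered abelian groups\<close>

text \<open>An abelian group is a \<^const>\<open>comm_group\<close>, hence written multiplicatively:
  \<open>x \<otimes> y\<close>, \<open>\<one>\<close>, \<open>inv x\<close> stand for \<open>x + y\<close>, \<open>0\<close>, \<open>-x\<close>.\<close>

definition group_cone :: "('g, 'b) monoid_scheme \<Rightarrow> 'g set \<Rightarrow> bool" where
  "group_cone G P \<longleftrightarrow> comm_group G \<and> P \<subseteq> carrier G \<and> \<one>\<^bsub>G\<^esub> \<in> P \<and>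
     (\<forall>x\<in>P. \<forall>y\<in>P. x \<otimes>\<^bsub>G\<^esub> y \<in> P)"

definition proper_cone :: "('g, 'b) monoid_scheme \<Rightarrow> 'g set \<Rightarrow> bool" where
  "proper_cone G P \<longleftrightarrow> P \<inter> (\<lambda>x. inv\<^bsub>G\<^esub> x) ` P = {\<one>\<^bsub>G\<^esub>}"

definition generating_cone :: "('g, 'b) monoid_scheme \<Rightarrow> 'g set \<Rightarrow> bool" where
  "generating_cone G P \<longleftrightarrow> carrier G = {x \<otimes>\<^bsub>G\<^esub> inv\<^bsub>G\<^esub> y | x y. x \<in> P \<and> y \<in> P}"

definition ordered_abelian_group :: "('g, 'b) monoid_scheme \<Rightarrow> 'g set \<Rightarrow> bool" where
  "ordered_abelian_group G P \<longleftrightarrow> group_cone G P \<and> proper_cone G P \<and> generating_cone G P"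

section \<open>Complex matrices\<close>

definition vec_l2norm :: "complex vec \<Rightarrow> real" where
  "vec_l2norm x = L2_set (\<lambda>i. cmod (x $ i)) {..<dim_vec x}"

definition op_norm :: "complex mat \<Rightarrow> real" where
  "op_norm a = (SUP x \<in> {x \<in> carrier_vec (dim_col a). vec_l2norm x \<le> 1}. vec_l2norm (a *\<^sub>v x))"

section \<open>Matrices over a complex vector space with involution\<close>

text \<open>
  The complex vector space \<open>V\<close> is a whole type \<open>'v\<close> with scalar multiplication \<open>scl\<close>.
  A matrix carries its dimensions, so a single function \<open>mabs\<close> represents the whole family of
  absolute values on the rectangular matrix spaces; and matrices of different sizes are
  different, in particular \<open>p\<close> and \<open>p \<oplus> 0\<close> are not identified. Only matrices with at least one
  row and one column are considered: \<open>carrier_mat m n\<close> with \<open>m = 0\<close> or \<open>n = 0\<close> never enters the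
  axioms or the definitions below.
\<close>

record 'v matrix_space =
  scl :: "complex \<Rightarrow> 'v \<Rightarrow> 'v"
  star :: "'v \<Rightarrow> 'v"
  mcone :: "nat \<Rightarrow> 'v mat set"
  ounit :: "'v"
  mabs :: "'v mat \<Rightarrow> 'v mat"

definition adj :: "'v matrix_space \<Rightarrow> 'v mat \<Rightarrow> 'v mat" where
  "adj V v = mat (dim_col v) (dim_row v) (\<lambda>(i, j). star V (v $$ (j, i)))"

definition lmult :: "'v::ab_group_add matrix_space \<Rightarrow> complex mat \<Rightarrow> 'v mat \<Rightarrow> 'v mat" where
  "lmult V a v = mat (dim_row a) (dim_col v)
     (\<lambda>(i, j). \<Sum>k<dim_row v. scl V (a $$ (i, k)) (v $$ (k, j)))"

definition rmult :: "'v::ab_group_add matrix_space \<Rightarrow> 'v mat \<Rightarrow> complex mat \<Rightarrow> 'v mat" where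
  "rmult V v b = mat (dim_row v) (dim_col b)
     (\<lambda>(i, j). \<Sum>k<dim_col v. scl V (b $$ (k, j)) (v $$ (i, k)))"

definition rscale :: "'v matrix_space \<Rightarrow> real \<Rightarrow> 'v mat \<Rightarrow> 'v mat" where
  "rscale V k v = map_mat (scl V (complex_of_real k)) v"

definition dsum :: "'v::zero mat \<Rightarrow> 'v mat \<Rightarrow> 'v mat" (infixl "\<oplus>\<^sub>m" 65) where
  "v \<oplus>\<^sub>m w = four_block_mat v (0\<^sub>m (dim_row v) (dim_col w)) (0\<^sub>m (dim_row w) (dim_col v)) w"

definition selfadj :: "'v matrix_space \<Rightarrow> nat \<Rightarrow> 'v mat set" where
  "selfadj V n = {v \<in> carrier_mat n n. adj V v = v}"

definition unit_mat :: "'v::zero matrix_space \<Rightarrow> nat \<Rightarrow> 'v mat" where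
  "unit_mat V n = mat n n (\<lambda>(i, j). if i = j then ounit V else 0)"

text \<open>The order unit norm of a square matrix.\<close>

definition mnorm :: "'v::zero matrix_space \<Rightarrow> 'v mat \<Rightarrow> real" where
  "mnorm V v = (let n = dim_row v; u = (\<lambda>k. rscale V k (unit_mat V n)) in
     Inf {k. 0 < k \<and> four_block_mat (u k) v (adj V v) (u k) \<in> mcone V (2 * n)})"

section \<open>Absolutely ordered spaces\<close>

text \<open>
  In the next two definitions \<open>X\<close> is a real vector space with the operations \<open>+\<close>, \<open>-\<close> and \<open>sm\<close>;
  they are applied only to the self-adjoint square matrices of a fixed size, where this is
  automatic. (Matrices are not an instance of the type class of real vector spaces, because
  their sizes vary.)
\<close>

definition real_cone :: "(real \<Rightarrow> 'x \<Rightarrow> 'x) \<Rightarrow> 'x::plus set \<Rightarrow> 'x set \<Rightarrow> bool" where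
  "real_cone sm X P \<longleftrightarrow> P \<subseteq> X \<and> P \<noteq> {} \<and> (\<forall>u\<in>P. \<forall>v\<in>P. u + v \<in> P) \<and>
     (\<forall>k\<ge>0. \<forall>u\<in>P. sm k u \<in> P)"

definition absolutely_ordered ::
    "(real \<Rightarrow> 'x \<Rightarrow> 'x) \<Rightarrow> 'x::{plus,minus} set \<Rightarrow> 'x set \<Rightarrow> ('x \<Rightarrow> 'x) \<Rightarrow> bool" where
  "absolutely_ordered sm X P ab \<longleftrightarrow>
     real_cone sm X P \<and>
     (\<forall>v\<in>X. ab v \<in> P) \<and>
     (\<forall>v\<in>P. ab v = v) \<and>
     (\<forall>v\<in>X. ab v + v \<in> P \<and> ab v - v \<in> P) \<and>
     (\<forall>v\<in>X. \<forall>k. ab (sm k v) = sm \<bar>k\<bar> (ab v)) \<and>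
     (\<forall>u\<in>X. \<forall>v\<in>X. \<forall>w\<in>P. ab (u - v) = u + v \<and> v - w \<in> P \<longrightarrow> ab (u - w) = u + w) \<and>
     (\<forall>u\<in>X. \<forall>v\<in>X. \<forall>w\<in>X. ab (u - v) = u + v \<and> ab (u - w) = u + w \<longrightarrow>
        ab (u - ab (v + w)) = u + ab (v + w) \<and> ab (u - ab (v - w)) = u + ab (v - w))"

section \<open>Absolute matrix order unit spaces\<close>

locale matrix_ordered_space =
  fixes V :: "'v::ab_group_add matrix_space"
  assumes vector_space: "vector_space (scl V)"
    and star_star: "star V (star V x) = x"
    and star_add: "star V (x + y) = star V x + star V y"
    and star_scl: "star V (scl V c x) = scl V (cnj c) (star V x)"
    and cone: "n \<ge> 1 \<Longrightarrow> real_cone (rscale V) (selfadj V n) (mcone V n)"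
    and cone_conjugate: "\<lbrakk>m \<ge> 1; n \<ge> 1; v \<in> mcone V n; a \<in> carrier_mat n m\<rbrakk> \<Longrightarrow>
      rmult V (lmult V (mat_adjoint a) v) a \<in> mcone V m"

text \<open>\<open>V\<close> is identified with the \<open>1 \<times> 1\<close> matrices over \<open>V\<close>.\<close>

locale matrix_order_unit_space = matrix_ordered_space +
  assumes unit_pos: "unit_mat V 1 \<in> mcone V 1"
    and order_unit: "v \<in> selfadj V 1 \<Longrightarrow> \<exists>k>0. rscale V k (unit_mat V 1) + v \<in> mcone V 1 \<and>
      rscale V k (unit_mat V 1) - v \<in> mcone V 1"
    and proper: "mcone V 1 \<inter> uminus ` mcone V 1 = {0\<^sub>m 1 1}"
    and archimedean: "\<lbrakk>n \<ge> 1; u \<in> mcone V n; v \<in> selfadj V n;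
      \<And>k. k > 0 \<Longrightarrow> rscale V k u + v \<in> mcone V n\<rbrakk> \<Longrightarrow> v \<in> mcone V n"

definition orth :: "'v::ab_group_add matrix_space \<Rightarrow> 'v mat \<Rightarrow> 'v mat \<Rightarrow> bool" where
  "orth V u v \<longleftrightarrow> mabs V (u - v) = u + v"

definition orth_inf :: "'v::ab_group_add matrix_space \<Rightarrow> 'v mat \<Rightarrow> 'v mat \<Rightarrow> bool" where
  "orth_inf V u v \<longleftrightarrow> (\<forall>k1 k2. mnorm V (rscale V k1 u + rscale V k2 v) =
     max (mnorm V (rscale V k1 u)) (mnorm V (rscale V k2 v)))"

definition abs_orth_inf ::
    "'v::ab_group_add matrix_space \<Rightarrow> nat \<Rightarrow> 'v mat \<Rightarrow> 'v mat \<Rightarrow> bool" where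
  "abs_orth_inf V n u v \<longleftrightarrow>
     (\<forall>u1 \<in> mcone V n. \<forall>v1 \<in> mcone V n. u - u1 \<in> mcone V n \<and> v - v1 \<in> mcone V n \<longrightarrow>
        orth_inf V u1 v1)"

locale absolute_matrix_order_unit_space = matrix_order_unit_space +
  assumes abs_in_cone: "\<lbrakk>m \<ge> 1; n \<ge> 1; v \<in> carrier_mat m n\<rbrakk> \<Longrightarrow> mabs V v \<in> mcone V n"
    and abs_ordered: "n \<ge> 1 \<Longrightarrow>
      absolutely_ordered (rscale V) (selfadj V n) (mcone V n) (mabs V)"
    and abs_mult: "\<lbrakk>m \<ge> 1; n \<ge> 1; r \<ge> 1; s \<ge> 1; v \<in> carrier_mat m n; a \<in> carrier_mat r m;
      b \<in> carrier_mat n s\<rbrakk> \<Longrightarrow>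
      rscale V (op_norm a) (mabs V (rmult V (mabs V v) b)) - mabs V (rmult V (lmult V a v) b)
        \<in> mcone V s"
    and abs_dsum: "\<lbrakk>m \<ge> 1; n \<ge> 1; r \<ge> 1; s \<ge> 1; v \<in> carrier_mat m n; w \<in> carrier_mat r s\<rbrakk> \<Longrightarrow>
      mabs V (v \<oplus>\<^sub>m w) = mabs V v \<oplus>\<^sub>m mabs V w"
    and orth_iff: "\<lbrakk>n \<ge> 1; u \<in> mcone V n; v \<in> mcone V n\<rbrakk> \<Longrightarrow>
      orth V u v \<longleftrightarrow> abs_orth_inf V n u v"

section \<open>Order projections and their equivalence\<close>

definition order_projections :: "'v::ab_group_add matrix_space \<Rightarrow> nat \<Rightarrow> 'v mat set" where
  "order_projections V n = {p \<in> carrier_mat n n. adj V p = p \<and>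
     mabs V (rscale V 2 p - unit_mat V n) = unit_mat V n}"

definition order_projections_inf :: "'v::ab_group_add matrix_space \<Rightarrow> 'v mat set" where
  "order_projections_inf V = (\<Union>n\<in>{1..}. order_projections V n)"

definition partial_isometries :: "'v::ab_group_add matrix_space \<Rightarrow> nat \<Rightarrow> nat \<Rightarrow> 'v mat set" where
  "partial_isometries V m n = {v \<in> carrier_mat m n.
     mabs V v \<in> order_projections V n \<and> mabs V (adj V v) \<in> order_projections V m}"

definition proj_equiv :: "'v::ab_group_add matrix_space \<Rightarrow> 'v mat \<Rightarrow> 'v mat \<Rightarrow> bool" where
  "proj_equiv V p q \<longleftrightarrow> (\<exists>v \<in> partial_isometries V (dim_row p) (dim_row q).
     p = mabs V (adj V v) \<and> q = mabs V v)"

definition stably_equiv :: "'v::ab_group_add matrix_space \<Rightarrow> 'v mat \<Rightarrow> 'v mat \<Rightarrow> bool" where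
  "stably_equiv V p q \<longleftrightarrow> (\<exists>r \<in> order_projections_inf V. proj_equiv V (p \<oplus>\<^sub>m r) (q \<oplus>\<^sub>m r))"

definition finite_projection :: "'v::ab_group_add matrix_space \<Rightarrow> nat \<Rightarrow> 'v mat \<Rightarrow> bool" where
  "finite_projection V n p \<longleftrightarrow> p \<in> order_projections V n \<and>
     (\<forall>q \<in> order_projections V n. p - q \<in> mcone V n \<and> proj_equiv V q p \<longrightarrow> q = p)"

definition condition_T :: "'v::ab_group_add matrix_space \<Rightarrow> bool" where
  "condition_T V \<longleftrightarrow> (\<forall>m\<ge>1. \<forall>n\<ge>1. \<forall>l\<ge>1.
     \<forall>u \<in> partial_isometries V m n. \<forall>v \<in> partial_isometries V l n. mabs V u = mabs V v \<longrightarrow>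
       (\<exists>w \<in> partial_isometries V m l.
          mabs V (adj V w) = mabs V (adj V u) \<and> mabs V w = mabs V (adj V v)))"

section \<open>The group \<open>K\<^sub>0(V)\<close>\<close>

definition K0_rel :: "'v::ab_group_add matrix_space \<Rightarrow> ('v mat \<times> 'v mat) rel" where
  "K0_rel V = {((p1, q1), (p2, q2)) | p1 q1 p2 q2.
     {p1, q1, p2, q2} \<subseteq> order_projections_inf V \<and> stably_equiv V (p1 \<oplus>\<^sub>m q2) (p2 \<oplus>\<^sub>m q1)}"

definition K0_class :: "'v::ab_group_add matrix_space \<Rightarrow> 'v mat \<Rightarrow> 'v mat \<Rightarrow> ('v mat \<times> 'v mat) set"
  where "K0_class V p q = K0_rel V `` {(p, q)}"

text \<open>
  The product of two classes is the union of the classes of the sums of all their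
  representatives; this is the common class of these sums once it is independent of the
  representatives. The zero projection is the \<open>1 \<times> 1\<close> zero matrix.
\<close>

definition K0 :: "'v::ab_group_add matrix_space \<Rightarrow> ('v mat \<times> 'v mat) set monoid" where
  "K0 V = \<lparr>carrier = (order_projections_inf V \<times> order_projections_inf V) // K0_rel V,
     monoid.mult = (\<lambda>A B. \<Union>(p1, q1)\<in>A. \<Union>(p2, q2)\<in>B. K0_class V (p1 \<oplus>\<^sub>m p2) (q1 \<oplus>\<^sub>m q2)),
     monoid.one = K0_class V (0\<^sub>m 1 1) (0\<^sub>m 1 1)\<rparr>"

definition K0_pos :: "'v::ab_group_add matrix_space \<Rightarrow> ('v mat \<times> 'v mat) set set" where
  "K0_pos V = {K0_class V p (0\<^sub>m 1 1) | p. p \<in> order_projections_inf V}"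

end

theory Submission
  imports Defs
begin

text \<open>
  Selecting and permuting rows is left multiplication by a matrix of norm at most 1, so
  \<open>|\<alpha> v| = |v|\<close> whenever \<open>\<alpha>\<close> only permutes rows or adds zero rows. This single consequence of the
  axiom on \<open>|\<alpha> v \<beta>|\<close> yields \<open>p \<oplus> q \<sim> q \<oplus> p\<close> and \<open>0 \<oplus> p \<sim> p\<close>, and together with the additivity of the
  absolute value on orthogonal elements it yields \<open>p \<oplus> (e - p) \<sim> e\<close>. Condition (T) is the
  transitivity of \<open>\<sim>\<close>, so the stable classes form a cancellative commutative monoid, and
  \<open>K\<^sub>0(V)\<close> is its group of differences. The cone is proper since \<open>p \<oplus> q \<oplus> r \<sim> 0 \<oplus> r\<close> makes a unit
  equivalent to a subprojection of itself, which by finiteness forces \<open>p \<oplus> q = 0\<close>.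
\<close>

section \<open>Block diagonal sums\<close>

lemma dsum_carrier [simp, intro]:
  "v \<in> carrier_mat m n \<Longrightarrow> w \<in> carrier_mat r s \<Longrightarrow> v \<oplus>\<^sub>m w \<in> carrier_mat (m + r) (n + s)"
  unfolding dsum_def by auto

lemma dim_dsum [simp]:
  "dim_row (v \<oplus>\<^sub>m w) = dim_row v + dim_row w" "dim_col (v \<oplus>\<^sub>m w) = dim_col v + dim_col w"
  unfolding dsum_def by auto

lemma index_dsum [simp]:
  assumes "i < dim_row v + dim_row w" "j < dim_col v + dim_col w"
  shows "(v \<oplus>\<^sub>m w) $$ (i, j) =
    (if i < dim_row v then if j < dim_col v then v $$ (i, j) else 0
     else if j < dim_col v then 0 else w $$ (i - dim_row v, j - dim_col v))"
  using assms unfolding dsum_def by auto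

lemma dsum_assoc: "(u \<oplus>\<^sub>m v) \<oplus>\<^sub>m w = u \<oplus>\<^sub>m (v \<oplus>\<^sub>m w)"
  using assoc_four_block_mat[of u v w] unfolding dsum_def by simp

lemma zero_dsum_zero: "0\<^sub>m k l \<oplus>\<^sub>m 0\<^sub>m m n = 0\<^sub>m (k + m) (l + n)"
  by (rule eq_matI) auto

lemma dsum_add:
  fixes a b c d :: "'v::ab_group_add mat"
  assumes "a \<in> carrier_mat m n" "b \<in> carrier_mat m n" "c \<in> carrier_mat r s" "d \<in> carrier_mat r s"
  shows "(a \<oplus>\<^sub>m c) + (b \<oplus>\<^sub>m d) = (a + b) \<oplus>\<^sub>m (c + d)"
  using assms by (intro eq_matI) auto

lemma dsum_minus:
  fixes a b c d :: "'v::ab_group_add mat"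
  assumes "a \<in> carrier_mat m n" "b \<in> carrier_mat m n" "c \<in> carrier_mat r s" "d \<in> carrier_mat r s"
  shows "(a \<oplus>\<^sub>m c) - (b \<oplus>\<^sub>m d) = (a - b) \<oplus>\<^sub>m (c - d)"
  using assms by (intro eq_matI) auto

lemma dsum_inject:
  assumes "a \<in> carrier_mat m n" "b \<in> carrier_mat m n" "c \<in> carrier_mat r s" "d \<in> carrier_mat r s"
    and eq: "a \<oplus>\<^sub>m c = b \<oplus>\<^sub>m d"
  shows "a = b" "c = d"
proof -
  have *: "(a \<oplus>\<^sub>m c) $$ (i, j) = (b \<oplus>\<^sub>m d) $$ (i, j)" for i j
    using eq by simp
  show "a = b"
  proof (rule eq_matI)
    fix i j assume "i < dim_row b" "j < dim_col b"
    then show "a $$ (i, j) = b $$ (i, j)" using *[of i j] assms(1-4) by auto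
  qed (use assms in auto)
  show "c = d"
  proof (rule eq_matI)
    fix i j assume "i < dim_row d" "j < dim_col d"
    then show "c $$ (i, j) = d $$ (i, j)" using *[of "m + i" "n + j"] assms(1-4) by auto
  qed (use assms in auto)
qed

text \<open>With \<open>w = adj V u\<close> this is the self-adjoint dilation of a rectangular
  \<open>u\<close>; with order projections \<open>p\<close>, \<open>q\<close> it is the flip that
  exchanges the summands of \<open>p \<oplus>\<^sub>m q\<close>.\<close>

definition antidiag :: "'v::zero mat \<Rightarrow> 'v mat \<Rightarrow> 'v mat" where
  "antidiag u w = four_block_mat (0\<^sub>m (dim_row u) (dim_col w)) u w (0\<^sub>m (dim_row w) (dim_col u))"

lemma dim_antidiag [simp]:
  "dim_row (antidiag u w) = dim_row u + dim_row w" "dim_col (antidiag u w) = dim_col w + dim_col u"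
  unfolding antidiag_def by auto

lemma antidiag_carrier:
  "u \<in> carrier_mat m n \<Longrightarrow> w \<in> carrier_mat r s \<Longrightarrow> antidiag u w \<in> carrier_mat (m + r) (s + n)"
  by auto

lemma index_antidiag [simp]:
  assumes "i < dim_row u + dim_row w" "j < dim_col w + dim_col u"
  shows "antidiag u w $$ (i, j) =
    (if i < dim_row u then if j < dim_col w then 0 else u $$ (i, j - dim_col w)
     else if j < dim_col w then w $$ (i - dim_row u, j) else 0)"
  using assms unfolding antidiag_def by auto

lemma antidiag_add:
  fixes u v w x :: "'v::ab_group_add mat"
  assumes "u \<in> carrier_mat m n" "v \<in> carrier_mat m n" "w \<in> carrier_mat r s" "x \<in> carrier_mat r s"
  shows "antidiag u w + antidiag v x = antidiag (u + v) (w + x)"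
  using assms by (intro eq_matI) auto

lemma unit_carrier [simp, intro]: "unit_mat V n \<in> carrier_mat n n"
  by (simp add: unit_mat_def)

lemma dim_unit [simp]: "dim_row (unit_mat V n) = n" "dim_col (unit_mat V n) = n"
  by (simp_all add: unit_mat_def)

lemma unit_dsum: "unit_mat V m \<oplus>\<^sub>m unit_mat V n = unit_mat V (m + n)"
  by (rule eq_matI) (auto simp: unit_mat_def)

lemma adj_carrier [simp, intro]: "v \<in> carrier_mat m n \<Longrightarrow> adj V v \<in> carrier_mat n m"
  by (auto simp: adj_def)

lemma dim_adj [simp]: "dim_row (adj V v) = dim_col v" "dim_col (adj V v) = dim_row v"
  by (simp_all add: adj_def)

lemma index_adj [simp]:
  "i < dim_col v \<Longrightarrow> j < dim_row v \<Longrightarrow> adj V v $$ (i, j) = star V (v $$ (j, i))"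
  by (simp add: adj_def)

lemma rscale_carrier [simp, intro]: "v \<in> carrier_mat m n \<Longrightarrow> rscale V k v \<in> carrier_mat m n"
  by (auto simp: rscale_def)

lemma dim_rscale [simp]: "dim_row (rscale V k v) = dim_row v" "dim_col (rscale V k v) = dim_col v"
  by (simp_all add: rscale_def)

lemma index_rscale [simp]:
  "i < dim_row v \<Longrightarrow> j < dim_col v \<Longrightarrow>
    rscale V k v $$ (i, j) = scl V (complex_of_real k) (v $$ (i, j))"
  by (simp add: rscale_def)

section \<open>Row selections\<close>

text \<open>An index \<open>g i\<close> outside \<open>{..<m}\<close> produces a zero row, so a
  single function encodes permuting rows, deleting rows and inserting zero rows.\<close>

definition row_selection :: "nat \<Rightarrow> nat \<Rightarrow> (nat \<Rightarrow> nat) \<Rightarrow> complex mat" where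
  "row_selection r m g = mat r m (\<lambda>(i, j). if g i = j then 1 else 0)"

lemma row_selection_mult_vec:
  assumes "x \<in> carrier_vec m"
  shows "row_selection r m g *\<^sub>v x = vec r (\<lambda>i. if g i < m then x $ (g i) else 0)"
proof (rule eq_vecI)
  fix i assume "i < dim_vec (vec r (\<lambda>i. if g i < m then x $ (g i) else 0))"
  then have i: "i < r" by simp
  have "(row_selection r m g *\<^sub>v x) $ i = (\<Sum>j<m. (if g i = j then 1 else 0) * x $ j)"
    using i assms by (simp add: row_selection_def scalar_prod_def atLeast0LessThan)
  also have "\<dots> = (\<Sum>j<m. if j = g i then x $ j else 0)"
    by (rule sum.cong) auto
  also have "\<dots> = (if g i < m then x $ (g i) else 0)"
    by simp
  finally show "(row_selection r m g *\<^sub>v x) $ i = vec r (\<lambda>i. if g i < m then x $ (g i) else 0) $ i"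
    using i by simp
qed (simp add: row_selection_def)

text \<open>The nonzero entries of the image are entries of \<open>x\<close> at distinct places, so
  their squares sum to at most the squared norm of \<open>x\<close>. Injectivity is asked only where
  \<open>g\<close> stays in range, since many rows may be sent to zero at once.\<close>

lemma op_norm_row_selection_le:
  assumes inj: "inj_on g {i. i < r \<and> g i < m}"
  shows "op_norm (row_selection r m g) \<le> 1"
  unfolding op_norm_def
proof (rule cSUP_least)
  have "vec_l2norm (0\<^sub>v (dim_col (row_selection r m g))) \<le> 1"
    by (simp add: vec_l2norm_def L2_set_def)
  then show "{x \<in> carrier_vec (dim_col (row_selection r m g)). vec_l2norm x \<le> 1} \<noteq> {}"
    by force
next
  fix x assume "x \<in> {x \<in> carrier_vec (dim_col (row_selection r m g)). vec_l2norm x \<le> 1}"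
  then have x: "x \<in> carrier_vec m" and le: "vec_l2norm x \<le> 1"
    by (auto simp: row_selection_def)
  let ?S = "{i. i < r \<and> g i < m}"
  have "(\<Sum>i<r. (cmod ((row_selection r m g *\<^sub>v x) $ i))\<^sup>2) =
      (\<Sum>i<r. if g i < m then (cmod (x $ g i))\<^sup>2 else 0)"
    by (rule sum.cong) (auto simp: row_selection_mult_vec[OF x])
  also have "\<dots> = (\<Sum>i\<in>?S. (cmod (x $ g i))\<^sup>2)"
    by (rule sum.mono_neutral_cong_right) auto
  also have "\<dots> = (\<Sum>j\<in>g ` ?S. (cmod (x $ j))\<^sup>2)"
    by (simp add: sum.reindex[OF inj])
  also have "\<dots> \<le> (\<Sum>j<m. (cmod (x $ j))\<^sup>2)"
    by (rule sum_mono2) auto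
  finally have "vec_l2norm (row_selection r m g *\<^sub>v x) \<le> vec_l2norm x"
    using x by (simp add: vec_l2norm_def L2_set_def row_selection_def)
  then show "vec_l2norm (row_selection r m g *\<^sub>v x) \<le> 1"
    using le by simp
qed

section \<open>Absolute values of matrices\<close>

context matrix_ordered_space
begin

interpretation sp: vector_space "scl V"
  by (rule vector_space)

section \<open>Involution, adjoints and real scaling\<close>

lemma star_zero [simp]: "star V 0 = 0"
  using star_add[of 0 0] by simp

lemma star_uminus: "star V (- x) = - star V x"
  using star_add[of x "- x"] by (metis add.right_inverse minus_unique star_zero)

lemma star_diff: "star V (x - y) = star V x - star V y"
  by (metis diff_conv_add_uminus star_add star_uminus)

lemma adj_adj [simp]: "adj V (adj V v) = v"
  by (rule eq_matI) (auto simp: star_star)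

lemma adj_dsum: "adj V (v \<oplus>\<^sub>m w) = adj V v \<oplus>\<^sub>m adj V w"
  by (rule eq_matI) auto

lemma adj_antidiag: "adj V (antidiag u w) = antidiag (adj V w) (adj V u)"
  by (rule eq_matI) auto

lemma adj_zero [simp]: "adj V (0\<^sub>m m n) = 0\<^sub>m n m"
  by (rule eq_matI) auto

lemma adj_add:
  "u \<in> carrier_mat m n \<Longrightarrow> v \<in> carrier_mat m n \<Longrightarrow> adj V (u + v) = adj V u + adj V v"
  by (intro eq_matI) (auto simp: star_add)

lemma adj_minus:
  "u \<in> carrier_mat m n \<Longrightarrow> v \<in> carrier_mat m n \<Longrightarrow> adj V (u - v) = adj V u - adj V v"
  by (intro eq_matI) (auto simp: star_diff)

lemma adj_rscale: "adj V (rscale V k v) = rscale V k (adj V v)"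
  by (intro eq_matI) (auto simp: star_scl)

lemma rscale_one [simp]: "rscale V 1 v = v"
  by (rule eq_matI) auto

lemma rscale_minus_one: "rscale V (-1) v = - v"
  by (rule eq_matI) auto

lemma rscale_rscale: "rscale V k (rscale V l v) = rscale V (k * l) v"
  by (rule eq_matI) auto

lemma rscale_zero [simp]: "rscale V k (0\<^sub>m m n) = 0\<^sub>m m n"
  by (rule eq_matI) auto

lemma rscale_two: "rscale V 2 v = v + v"
proof (rule eq_matI)
  fix i j assume "i < dim_row (v + v)" "j < dim_col (v + v)"
  then show "rscale V 2 v $$ (i, j) = (v + v) $$ (i, j)"
    using sp.scale_left_distrib[of 1 1 "v $$ (i, j)"] by simp
qed auto

lemma rscale_add:
  "u \<in> carrier_mat m n \<Longrightarrow> v \<in> carrier_mat m n \<Longrightarrow> rscale V k (u + v) = rscale V k u + rscale V k v"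
  by (intro eq_matI) (auto simp: sp.scale_right_distrib)

lemma rscale_minus:
  "u \<in> carrier_mat m n \<Longrightarrow> v \<in> carrier_mat m n \<Longrightarrow> rscale V k (u - v) = rscale V k u - rscale V k v"
  by (intro eq_matI) (auto simp: sp.scale_right_diff_distrib)

lemma rscale_diff_left:
  "v \<in> carrier_mat m n \<Longrightarrow> rscale V (k - l) v = rscale V k v - rscale V l v"
  by (intro eq_matI) (auto simp: sp.scale_left_diff_distrib)

lemma rscale_dsum: "rscale V k (v \<oplus>\<^sub>m w) = rscale V k v \<oplus>\<^sub>m rscale V k w"
  by (rule eq_matI) auto

text \<open>The type \<open>'v\<close> is only an additive group, so 2 is cancelled through the
  scalar 1/2 of \<open>scl V\<close>.\<close>

lemma double_cancel:
  fixes u v :: "'v mat"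
  assumes "u \<in> carrier_mat m n" "v \<in> carrier_mat m n" "u + u = v + v"
  shows "u = v"
proof -
  have "rscale V (1/2) (rscale V 2 u) = rscale V (1/2) (rscale V 2 v)"
    using assms by (simp add: rscale_two)
  then show ?thesis by (simp add: rscale_rscale)
qed

section \<open>Self-adjoint matrices and the matrix cones\<close>

lemma selfadj_add: "u \<in> selfadj V n \<Longrightarrow> v \<in> selfadj V n \<Longrightarrow> u + v \<in> selfadj V n"
  by (auto simp: selfadj_def adj_add)

lemma selfadj_minus: "u \<in> selfadj V n \<Longrightarrow> v \<in> selfadj V n \<Longrightarrow> u - v \<in> selfadj V n"
  by (auto simp: selfadj_def adj_minus minus_carrier_mat)

lemma selfadj_rscale: "u \<in> selfadj V n \<Longrightarrow> rscale V k u \<in> selfadj V n"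
  by (auto simp: selfadj_def adj_rscale)

lemma selfadj_carrier: "u \<in> selfadj V n \<Longrightarrow> u \<in> carrier_mat n n"
  by (simp add: selfadj_def)

lemma cone_selfadj: "n \<ge> 1 \<Longrightarrow> u \<in> mcone V n \<Longrightarrow> u \<in> selfadj V n"
  using cone[of n] by (auto simp: real_cone_def)

lemma cone_carrier: "n \<ge> 1 \<Longrightarrow> u \<in> mcone V n \<Longrightarrow> u \<in> carrier_mat n n"
  using cone_selfadj selfadj_carrier by blast

lemma cone_add: "n \<ge> 1 \<Longrightarrow> u \<in> mcone V n \<Longrightarrow> v \<in> mcone V n \<Longrightarrow> u + v \<in> mcone V n"
  using cone[of n] by (auto simp: real_cone_def)

lemma cone_rscale: "n \<ge> 1 \<Longrightarrow> u \<in> mcone V n \<Longrightarrow> k \<ge> 0 \<Longrightarrow> rscale V k u \<in> mcone V n"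
  using cone[of n] by (auto simp: real_cone_def)

text \<open>\<open>real_cone\<close> gives a nonempty set closed under scaling by
  \<open>k \<ge> 0\<close>; zero arises as 0 times any of its elements.\<close>

lemma zero_in_cone: "n \<ge> 1 \<Longrightarrow> 0\<^sub>m n n \<in> mcone V n"
proof -
  assume n: "n \<ge> 1"
  obtain u where u: "u \<in> mcone V n" using cone[OF n] by (auto simp: real_cone_def)
  have "rscale V 0 u = 0\<^sub>m n n"
    using cone_carrier[OF n u] by (intro eq_matI) auto
  then show ?thesis using cone_rscale[OF n u, of 0] by simp
qed

text \<open>Serves to specialise \<open>abs_mult\<close> to \<open>b = 1\<close>, where only the
  left factor acts.\<close>

lemma rmult_one:
  assumes "v \<in> carrier_mat m n"
  shows "rmult V v (1\<^sub>m n) = v"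
proof (rule eq_matI)
  fix i j assume ij: "i < dim_row v" "j < dim_col v"
  have "(\<Sum>k<n. scl V (1\<^sub>m n $$ (k, j)) (v $$ (i, k))) = (\<Sum>k<n. if k = j then v $$ (i, k) else 0)"
    using ij assms by (intro sum.cong) auto
  then show "rmult V v (1\<^sub>m n) $$ (i, j) = v $$ (i, j)"
    using ij assms by (simp add: rmult_def)
qed (use assms in \<open>auto simp: rmult_def\<close>)

lemma lmult_row_selection:
  assumes "v \<in> carrier_mat m n"
  shows "lmult V (row_selection r m g) v =
    mat r n (\<lambda>(i, j). if g i < m then v $$ (g i, j) else 0)"
proof (rule eq_matI)
  fix i j assume "i < dim_row (mat r n (\<lambda>(i, j). if g i < m then v $$ (g i, j) else 0))"
    "j < dim_col (mat r n (\<lambda>(i, j). if g i < m then v $$ (g i, j) else 0))"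
  then have ij: "i < r" "j < n" by auto
  have "(\<Sum>k<m. scl V (row_selection r m g $$ (i, k)) (v $$ (k, j))) =
      (\<Sum>k<m. if k = g i then v $$ (k, j) else 0)"
    using ij by (intro sum.cong) (auto simp: row_selection_def)
  then show "lmult V (row_selection r m g) v $$ (i, j) =
      mat r n (\<lambda>(i, j). if g i < m then v $$ (g i, j) else 0) $$ (i, j)"
    using ij assms by (simp add: lmult_def row_selection_def)
qed (use assms in \<open>auto simp: lmult_def row_selection_def\<close>)

end

context absolute_matrix_order_unit_space
begin

lemma abs_cone [simp]: "n \<ge> 1 \<Longrightarrow> u \<in> mcone V n \<Longrightarrow> mabs V u = u"
  using abs_ordered[of n] by (auto simp: absolutely_ordered_def)

lemma abs_rscale: "n \<ge> 1 \<Longrightarrow> v \<in> selfadj V n \<Longrightarrow> mabs V (rscale V k v) = rscale V \<bar>k\<bar> (mabs V v)"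
  using abs_ordered[of n] by (auto simp: absolutely_ordered_def)

lemma abs_uminus: "n \<ge> 1 \<Longrightarrow> v \<in> selfadj V n \<Longrightarrow> mabs V (- v) = mabs V v"
  using abs_rscale[of n v "-1"] by (simp add: rscale_minus_one)

lemma abs_plus_cone: "n \<ge> 1 \<Longrightarrow> v \<in> selfadj V n \<Longrightarrow> mabs V v + v \<in> mcone V n"
  and abs_minus_cone: "n \<ge> 1 \<Longrightarrow> v \<in> selfadj V n \<Longrightarrow> mabs V v - v \<in> mcone V n"
  using abs_ordered[of n] by (auto simp: absolutely_ordered_def)

lemma abs_carrier: "m \<ge> 1 \<Longrightarrow> n \<ge> 1 \<Longrightarrow> v \<in> carrier_mat m n \<Longrightarrow> mabs V v \<in> carrier_mat n n"
  using abs_in_cone cone_carrier by blast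

text \<open>At every size, properness comes from the absolute value: if \<open>w\<close> and
  \<open>-w\<close> are both positive, then \<open>w = |w| = |-w| = -w\<close>, so
  \<open>w + w = 0\<close>.\<close>

lemma cone_antisym:
  assumes n: "n \<ge> 1" and uv: "u \<in> carrier_mat n n" "v \<in> carrier_mat n n"
    and le: "u - v \<in> mcone V n" "v - u \<in> mcone V n"
  shows "u = v"
proof -
  have "- (u - v) = v - u"
    using uv by (intro eq_matI) auto
  then have "v - u = u - v"
    using abs_uminus[OF n cone_selfadj[OF n le(1)]] n le by simp
  then have eq: "(v - u) $$ (i, j) = (u - v) $$ (i, j)" for i j by simp
  have "v + v = u + u"
  proof (rule eq_matI)
    fix i j assume "i < dim_row (u + u)" "j < dim_col (u + u)"
    then show "(v + v) $$ (i, j) = (u + u) $$ (i, j)"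
      using eq[of i j] uv by (auto simp: algebra_simps)
  qed (use uv in auto)
  then show ?thesis using double_cancel[OF uv(2,1)] by simp
qed

section \<open>Absolute values under permutation and padding of rows\<close>

text \<open>With \<open>b = 1\<close> the axiom \<open>abs_mult\<close> bounds
  \<open>|\<alpha> v|\<close> by the norm of \<alpha> times \<open>|v|\<close>. Since that norm is
  at most 1, the missing multiple of \<open>|v|\<close> is positive and can be added.\<close>

lemma abs_row_selection_le:
  assumes mnr: "m \<ge> 1" "n \<ge> 1" "r \<ge> 1" and v: "v \<in> carrier_mat m n"
    and inj: "inj_on g {i. i < r \<and> g i < m}"
  shows "mabs V v - mabs V (mat r n (\<lambda>(i, j). if g i < m then v $$ (g i, j) else 0)) \<in> mcone V n"
proof -
  let ?a = "row_selection r m g" and ?w = "mat r n (\<lambda>(i, j). if g i < m then v $$ (g i, j) else 0)"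
  have a: "?a \<in> carrier_mat r m" by (simp add: row_selection_def)
  have vc: "mabs V v \<in> mcone V n" using mnr v abs_in_cone by blast
  then have vm: "mabs V v \<in> carrier_mat n n" using mnr cone_carrier by blast
  have wm: "mabs V ?w \<in> carrier_mat n n" using mnr abs_carrier[of r n ?w] by simp
  have w: "?w \<in> carrier_mat r n" by simp
  have "rscale V (op_norm ?a) (mabs V v) - mabs V ?w \<in> mcone V n"
    using abs_mult[OF mnr(1,2,3) mnr(2) v a one_carrier_mat]
    by (simp add: rmult_one[OF vm] lmult_row_selection[OF v] rmult_one[OF w] abs_cone[OF mnr(2) vc])
  moreover have "rscale V (1 - op_norm ?a) (mabs V v) \<in> mcone V n"
    using op_norm_row_selection_le[OF inj] by (intro cone_rscale[OF mnr(2) vc]) simp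
  ultimately have "rscale V (1 - op_norm ?a) (mabs V v) +
      (rscale V (op_norm ?a) (mabs V v) - mabs V ?w) \<in> mcone V n"
    using cone_add[OF mnr(2)] by blast
  moreover have "rscale V (1 - op_norm ?a) (mabs V v) +
      (rscale V (op_norm ?a) (mabs V v) - mabs V ?w) = mabs V v - mabs V ?w"
    using vm wm by (subst rscale_diff_left[OF vm]) (intro eq_matI, auto)
  ultimately show ?thesis by simp
qed

text \<open>If \<open>v\<close> and \<open>w\<close> are row selections of each other, both
  inequalities hold and antisymmetry of the cone order gives equality.\<close>

lemma abs_row_selection_eq:
  assumes mnr: "m \<ge> 1" "n \<ge> 1" "r \<ge> 1" and v: "v \<in> carrier_mat m n" and w: "w \<in> carrier_mat r n"
    and inj: "inj_on g {i. i < r \<and> g i < m}" "inj_on h {i. i < m \<and> h i < r}"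
    and wv: "\<And>i j. i < r \<Longrightarrow> j < n \<Longrightarrow> w $$ (i, j) = (if g i < m then v $$ (g i, j) else 0)"
    and vw: "\<And>i j. i < m \<Longrightarrow> j < n \<Longrightarrow> v $$ (i, j) = (if h i < r then w $$ (h i, j) else 0)"
  shows "mabs V w = mabs V v"
proof (rule cone_antisym[OF mnr(2)])
  have "mat r n (\<lambda>(i, j). if g i < m then v $$ (g i, j) else 0) = w"
    using w wv by (intro eq_matI) auto
  then show "mabs V v - mabs V w \<in> mcone V n"
    using abs_row_selection_le[OF mnr v inj(1)] by simp
  have "mat m n (\<lambda>(i, j). if h i < r then w $$ (h i, j) else 0) = v"
    using v vw by (intro eq_matI) auto
  then show "mabs V w - mabs V v \<in> mcone V n"
    using abs_row_selection_le[OF mnr(3,2,1) w inj(2)] by simp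
  show "mabs V w \<in> carrier_mat n n" "mabs V v \<in> carrier_mat n n"
    using abs_carrier mnr v w by auto
qed

lemma abs_zero: "m \<ge> 1 \<Longrightarrow> n \<ge> 1 \<Longrightarrow> mabs V (0\<^sub>m m n) = 0\<^sub>m n n"
  \<comment> \<open>The square zero matrix is positive, hence its own absolute value. The constant
    functions are out of range everywhere, so they turn every row into a zero row.\<close>
  using abs_row_selection_eq[of n n m "0\<^sub>m n n" "0\<^sub>m m n" "\<lambda>_. n" "\<lambda>_. m"] zero_in_cone[of n] by simp

lemma abs_append_zero:
  assumes mnk: "m \<ge> 1" "n \<ge> 1" and v: "v \<in> carrier_mat m n"
  shows "mabs V (v @\<^sub>r 0\<^sub>m k n) = mabs V v" "mabs V (0\<^sub>m k n @\<^sub>r v) = mabs V v"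
proof -
  show "mabs V (v @\<^sub>r 0\<^sub>m k n) = mabs V v"
    using mnk v by (intro abs_row_selection_eq[of m n "m + k" _ _ id id])
      (auto simp: append_rows_def)
  show "mabs V (0\<^sub>m k n @\<^sub>r v) = mabs V v"
    \<comment> \<open>The value \<open>m\<close> is the first index out of range, so the top
      \<open>k\<close> rows become zero; the other rows are shifted by \<open>k\<close>.\<close>
    using mnk v by (intro abs_row_selection_eq[of m n "k + m" _ _
      "\<lambda>i. if i < k then m else i - k" "\<lambda>i. k + i"])
      (auto simp: append_rows_def inj_on_def split: if_splits)
qed

lemma adj_append_zero:
  assumes v: "v \<in> carrier_mat m n"
  shows "adj V (v @\<^sub>r 0\<^sub>m k n) @\<^sub>r 0\<^sub>m k (m + k) = adj V v \<oplus>\<^sub>m 0\<^sub>m k k"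
    "0\<^sub>m k (k + m) @\<^sub>r adj V (0\<^sub>m k n @\<^sub>r v) = 0\<^sub>m k k \<oplus>\<^sub>m adj V v"
  using v by (auto intro!: eq_matI simp: append_rows_def)

text \<open>The adjoint has zero columns, on which row selections do not act. Padding it with zero
  rows leaves the absolute value unchanged and makes it block diagonal, where
  \<open>abs_dsum\<close> applies.\<close>

lemma abs_adj_append_zero:
  assumes mnk: "m \<ge> 1" "n \<ge> 1" "k \<ge> 1" and v: "v \<in> carrier_mat m n"
  shows "mabs V (adj V (v @\<^sub>r 0\<^sub>m k n)) = mabs V (adj V v) \<oplus>\<^sub>m 0\<^sub>m k k"
    "mabs V (adj V (0\<^sub>m k n @\<^sub>r v)) = 0\<^sub>m k k \<oplus>\<^sub>m mabs V (adj V v)"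
proof -
  have c: "v @\<^sub>r 0\<^sub>m k n \<in> carrier_mat (m + k) n" "0\<^sub>m k n @\<^sub>r v \<in> carrier_mat (k + m) n"
    using v by auto
  show "mabs V (adj V (v @\<^sub>r 0\<^sub>m k n)) = mabs V (adj V v) \<oplus>\<^sub>m 0\<^sub>m k k"
    using abs_append_zero(1)[of n "m + k" "adj V (v @\<^sub>r 0\<^sub>m k n)" k] c mnk
      abs_dsum[of n m k k "adj V v" "0\<^sub>m k k"] v
    by (simp add: adj_append_zero abs_zero)
  show "mabs V (adj V (0\<^sub>m k n @\<^sub>r v)) = 0\<^sub>m k k \<oplus>\<^sub>m mabs V (adj V v)"
    using abs_append_zero(2)[of n "k + m" "adj V (0\<^sub>m k n @\<^sub>r v)" k] c mnk
      abs_dsum[of k k n m "0\<^sub>m k k" "adj V v"] v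
    by (simp add: adj_append_zero abs_zero)
qed

text \<open>Swapping the two blocks of rows turns \<open>antidiag u w\<close> into
  \<open>w \<oplus>\<^sub>m u\<close>, and this swap preserves the absolute value.\<close>

lemma abs_antidiag:
  assumes "m \<ge> 1" "n \<ge> 1" "r \<ge> 1" "s \<ge> 1" and u: "u \<in> carrier_mat m n" and w: "w \<in> carrier_mat r s"
  shows "mabs V (antidiag u w) = mabs V w \<oplus>\<^sub>m mabs V u"
proof -
  have "mabs V (antidiag u w) = mabs V (w \<oplus>\<^sub>m u)"
    using assms by (intro abs_row_selection_eq[of "r + m" "s + n" "m + r" _ _
      "\<lambda>i. if i < m then r + i else i - m" "\<lambda>i. if i < r then m + i else i - r"])
      (auto simp: inj_on_def split: if_splits)
  then show ?thesis using assms abs_dsum by simp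
qed

section \<open>Orthogonality and additivity of the absolute value\<close>

lemma orth_sym:
  assumes "n \<ge> 1" "u \<in> selfadj V n" "v \<in> selfadj V n" "orth V u v"
  shows "orth V v u"
proof -
  have "v - u = - (u - v)" "v + u = u + v"
    using assms(2,3)[THEN selfadj_carrier] by (auto intro!: eq_matI)
  then show ?thesis
    using assms abs_uminus[OF assms(1) selfadj_minus[OF assms(2,3)]] by (simp add: orth_def)
qed

lemma orth_mono:
  "n \<ge> 1 \<Longrightarrow> u \<in> selfadj V n \<Longrightarrow> v \<in> selfadj V n \<Longrightarrow> orth V u v \<Longrightarrow> w \<in> mcone V n \<Longrightarrow>
    v - w \<in> mcone V n \<Longrightarrow> orth V u w"
  using abs_ordered[of n] unfolding absolutely_ordered_def orth_def by blast

text \<open>The axiom makes \<open>u\<close> orthogonal to \<open>|v + w|\<close>, which is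
  \<open>v + w\<close> itself because the sum is positive.\<close>

lemma orth_add:
  assumes n: "n \<ge> 1" and u: "u \<in> selfadj V n" and vw: "v \<in> mcone V n" "w \<in> mcone V n"
    and "orth V u v" "orth V u w"
  shows "orth V u (v + w)"
proof -
  have "orth V u (mabs V (v + w))"
    using abs_ordered[OF n] u vw[THEN cone_selfadj[OF n]] assms(5,6)
    unfolding absolutely_ordered_def orth_def by blast
  then show ?thesis using abs_cone[OF n cone_add[OF n vw]] by simp
qed

text \<open>The two elements are the positive and negative parts, half of \<open>|a| + a\<close> and
  half of \<open>|a| - a\<close>.\<close>

lemma orthogonal_decomposition:
  assumes n: "n \<ge> 1" and a: "a \<in> selfadj V n"
  obtains b c where "b \<in> mcone V n" "c \<in> mcone V n" "a = b - c" "mabs V a = b + c"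
proof
  let ?b = "rscale V (1/2) (mabs V a + a)" and ?c = "rscale V (1/2) (mabs V a - a)"
  show "?b \<in> mcone V n" "?c \<in> mcone V n"
    using cone_rscale[OF n] abs_plus_cone[OF n a] abs_minus_cone[OF n a] by simp_all
  have ca: "a \<in> carrier_mat n n" using a by (rule selfadj_carrier)
  have cb: "mabs V a \<in> carrier_mat n n" using abs_carrier n ca by blast
  have "?b - ?c = rscale V (1/2) ((mabs V a + a) - (mabs V a - a))"
    using ca cb by (intro rscale_minus[symmetric]) auto
  also have "(mabs V a + a) - (mabs V a - a) = rscale V 2 a"
    unfolding rscale_two using ca cb by (intro eq_matI) auto
  finally show "a = ?b - ?c" by (simp add: rscale_rscale)
  have "?b + ?c = rscale V (1/2) ((mabs V a + a) + (mabs V a - a))"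
    using ca cb by (intro rscale_add[symmetric]) auto
  also have "(mabs V a + a) + (mabs V a - a) = rscale V 2 (mabs V a)"
    unfolding rscale_two using ca cb by (intro eq_matI) auto
  finally show "mabs V a = ?b + ?c" by (simp add: rscale_rscale)
qed

text \<open>Split \<open>a = c - d\<close> and \<open>b = f - g\<close> into positive and negative
  parts. Each part lies below \<open>|a|\<close> or \<open>|b|\<close>, so parts of \<open>a\<close>
  and of \<open>b\<close> are orthogonal. Then \<open>c + f\<close> and \<open>d + g\<close> are
  orthogonal with difference \<open>a + b\<close>, and their sum is
  \<open>|a| + |b|\<close>.\<close>

lemma abs_add_selfadj:
  assumes n: "n \<ge> 1" and a: "a \<in> selfadj V n" and b: "b \<in> selfadj V n"
    and ab: "orth V (mabs V a) (mabs V b)"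
  shows "mabs V (a + b) = mabs V a + mabs V b"
proof -
  obtain c d where c: "c \<in> mcone V n" and d: "d \<in> mcone V n"
    and acd: "a = c - d" "mabs V a = c + d"
    using orthogonal_decomposition[OF n a] .
  obtain f g where f: "f \<in> mcone V n" and g: "g \<in> mcone V n"
    and bfg: "b = f - g" "mabs V b = f + g"
    using orthogonal_decomposition[OF n b] .
  note sa = c[THEN cone_selfadj[OF n]] d[THEN cone_selfadj[OF n]]
    f[THEN cone_selfadj[OF n]] g[THEN cone_selfadj[OF n]]
  note car = sa[THEN selfadj_carrier]
  have diffs: "c + d - c = d" "c + d - d = c" "f + g - f = g" "f + g - g = f"
    using car by (auto intro!: eq_matI)
  have abs_sa: "c + d \<in> selfadj V n" "f + g \<in> selfadj V n"
    using sa selfadj_add by auto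
  have "orth V (c + d) f" "orth V (c + d) g"
    using orth_mono[OF n abs_sa] ab acd bfg f g by (auto simp: diffs)
  then have "orth V f (c + d)" "orth V g (c + d)"
    using orth_sym[OF n abs_sa(1)] sa by auto
  then have fd: "orth V f d" and gc: "orth V g c"
    using orth_mono[OF n sa(3) abs_sa(1) _ d] orth_mono[OF n sa(4) abs_sa(1) _ c] c d
    by (auto simp: diffs)
  have cd: "orth V c d" and fg: "orth V f g"
    using acd bfg by (auto simp: orth_def)
  \<comment> \<open>It remains to assemble the four pairs of opposite sign: \<open>c\<close> and
    \<open>f\<close> are each orthogonal to \<open>d\<close> and to \<open>g\<close>. Sums are
    formed in the second argument, with symmetry used to reach the first.\<close>
  have "orth V c (d + g)"
    using orth_add[OF n sa(1) d g] cd orth_sym[OF n sa(4,1) gc] by blast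
  moreover have "orth V f (d + g)"
    using orth_add[OF n sa(3) d g] fd fg by blast
  ultimately have "orth V (d + g) (c + f)"
    using orth_add[OF n selfadj_add[OF sa(2,4)] c f]
      orth_sym[OF n _ selfadj_add[OF sa(2,4)]] sa by blast
  then have "orth V (c + f) (d + g)"
    using orth_sym[OF n selfadj_add[OF sa(2,4)] selfadj_add[OF sa(1,3)]] by blast
  moreover have "(c + f) - (d + g) = a + b" "(c + f) + (d + g) = mabs V a + mabs V b"
    unfolding acd(2) bfg(2) using acd(1) bfg(1) car by (auto intro!: eq_matI)
  ultimately show ?thesis by (simp add: orth_def)
qed

text \<open>The self-adjoint matrix \<open>[0, u; u\<^sup>*, 0]\<close> has absolute value \<open>|u\<^sup>*| \<oplus> |u|\<close>, which reduces
  rectangular matrices to self-adjoint ones.\<close>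

lemma abs_add_orth:
  assumes m: "m \<ge> 1" and n: "n \<ge> 1" and u: "u \<in> carrier_mat m n" and v: "v \<in> carrier_mat m n"
    and o1: "orth V (mabs V u) (mabs V v)" and o2: "orth V (mabs V (adj V u)) (mabs V (adj V v))"
  shows "mabs V (u + v) = mabs V u + mabs V v"
    "mabs V (adj V (u + v)) = mabs V (adj V u) + mabs V (adj V v)"
proof -
  define A where "A w = antidiag w (adj V w)" for w
  have A: "A w \<in> selfadj V (m + n)" "mabs V (A w) = mabs V (adj V w) \<oplus>\<^sub>m mabs V w"
    if "w \<in> carrier_mat m n" for w
    using that abs_antidiag[OF m n n m that adj_carrier[OF that]]
      antidiag_carrier[OF that adj_carrier[OF that]]
    by (auto simp: A_def selfadj_def adj_antidiag)
  have uv: "u + v \<in> carrier_mat m n" using u v by simp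
  note car = abs_carrier[OF m n] abs_carrier[OF n m adj_carrier]
  have n': "m + n \<ge> 1" using m by simp
  have sa: "mabs V w \<in> selfadj V n" "mabs V (adj V w) \<in> selfadj V m" if "w \<in> carrier_mat m n" for w
    using cone_selfadj abs_in_cone m n that adj_carrier by blast+
  \<comment> \<open>Differences and sums of block diagonal matrices are taken blockwise and
    \<open>abs_dsum\<close> splits the absolute value, so \<open>o1\<close> and \<open>o2\<close>
    together give orthogonality of the dilations.\<close>
  have "orth V (mabs V (A u)) (mabs V (A v))"
    unfolding orth_def A(2)[OF u] A(2)[OF v]
      dsum_minus[OF car(2)[OF u] car(2)[OF v] car(1)[OF u] car(1)[OF v]]
      dsum_add[OF car(2)[OF u] car(2)[OF v] car(1)[OF u] car(1)[OF v]]
    using o1 o2 u v car m n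
    by (subst abs_dsum[of m m n n]) (auto simp: orth_def intro!: minus_carrier_mat)
  then have "mabs V (A u + A v) = mabs V (A u) + mabs V (A v)"
    using abs_add_selfadj[OF n' A(1)[OF u] A(1)[OF v]] by simp
  moreover have "A u + A v = A (u + v)"
    using antidiag_add[OF u v adj_carrier[OF u] adj_carrier[OF v]] adj_add[OF u v]
    by (simp add: A_def)
  ultimately have eq: "mabs V (adj V (u + v)) \<oplus>\<^sub>m mabs V (u + v) =
      (mabs V (adj V u) + mabs V (adj V v)) \<oplus>\<^sub>m (mabs V u + mabs V v)"
    using A(2)[OF uv] A(2)[OF u] A(2)[OF v]
      dsum_add[OF car(2)[OF u] car(2)[OF v] car(1)[OF u] car(1)[OF v]] by simp
  note inj = dsum_inject[OF car(2)[OF uv] add_carrier_mat[OF car(2)[OF v]]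
    car(1)[OF uv] add_carrier_mat[OF car(1)[OF v]] eq]
  show "mabs V (u + v) = mabs V u + mabs V v"
    "mabs V (adj V (u + v)) = mabs V (adj V u) + mabs V (adj V v)"
    by (rule inj(2), rule inj(1))
qed

section \<open>Order projections\<close>

lemma order_projection_iff:
  "p \<in> order_projections V n \<longleftrightarrow>
    p \<in> selfadj V n \<and> mabs V (rscale V 2 p - unit_mat V n) = unit_mat V n"
  by (auto simp: order_projections_def selfadj_def)

text \<open>Positivity of the unit is given in size 1. Additivity over
  \<open>\<oplus>\<^sub>m\<close> shows by induction that \<open>unit_mat V n\<close> is its own
  absolute value, and absolute values are positive.\<close>

lemma unit_in_cone: "n \<ge> 1 \<Longrightarrow> unit_mat V n \<in> mcone V n"
proof -
  have "mabs V (unit_mat V n) = unit_mat V n" if "n \<ge> 1" for n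
    using that
  proof (induction n rule: dec_induct)
    case base
    then show ?case using abs_cone[OF _ unit_pos] by simp
  next
    case (step n)
    have "mabs V (unit_mat V n \<oplus>\<^sub>m unit_mat V 1) = mabs V (unit_mat V n) \<oplus>\<^sub>m mabs V (unit_mat V 1)"
      using step by (intro abs_dsum[of n n 1 1]) auto
    then show ?case using step abs_cone[OF _ unit_pos] by (simp add: unit_dsum)
  qed
  then show "n \<ge> 1 \<Longrightarrow> unit_mat V n \<in> mcone V n"
    using abs_in_cone[of n n "unit_mat V n"] by simp
qed

lemma unit_selfadj: "n \<ge> 1 \<Longrightarrow> unit_mat V n \<in> selfadj V n"
  using unit_in_cone cone_selfadj by blast

lemma proj_carrier: "p \<in> order_projections V n \<Longrightarrow> p \<in> carrier_mat n n"
  by (simp add: order_projections_def)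

lemma proj_adj: "p \<in> order_projections V n \<Longrightarrow> adj V p = p"
  by (simp add: order_projections_def)

text \<open>As \<open>|2p - e| = e\<close>, the element \<open>2p = e + (2p - e)\<close> has the
  form \<open>|x| + x\<close>.\<close>

lemma proj_in_cone:
  assumes n: "n \<ge> 1" and p: "p \<in> order_projections V n"
  shows "p \<in> mcone V n"
proof -
  have sa: "p \<in> selfadj V n" and ab: "mabs V (rscale V 2 p - unit_mat V n) = unit_mat V n"
    using p by (auto simp: order_projection_iff)
  have "unit_mat V n + (rscale V 2 p - unit_mat V n) \<in> mcone V n"
    using abs_plus_cone[OF n selfadj_minus[OF selfadj_rscale[OF sa] unit_selfadj[OF n]], of 2] ab
    by simp
  moreover have "unit_mat V n + (rscale V 2 p - unit_mat V n) = rscale V 2 p"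
    using proj_carrier[OF p] by (intro eq_matI) auto
  ultimately show ?thesis
    using cone_rscale[OF n, of "rscale V 2 p" "1/2"] by (simp add: rscale_rscale)
qed

lemma proj_abs: "n \<ge> 1 \<Longrightarrow> p \<in> order_projections V n \<Longrightarrow> mabs V p = p"
  using proj_in_cone abs_cone by blast

text \<open>Replacing \<open>p\<close> by \<open>e - p\<close> only changes the sign of
  \<open>2p - e\<close>. Moreover \<open>p - (e - p) = 2p - e\<close>, so the equation defining an
  order projection is also the orthogonality of \<open>p\<close> and \<open>e - p\<close>.\<close>

lemma proj_compl:
  assumes n: "n \<ge> 1" and p: "p \<in> order_projections V n"
  shows "unit_mat V n - p \<in> order_projections V n" "orth V p (unit_mat V n - p)"
    "p + (unit_mat V n - p) = unit_mat V n"
proof -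
  have sa: "p \<in> selfadj V n" and ab: "mabs V (rscale V 2 p - unit_mat V n) = unit_mat V n"
    using p by (auto simp: order_projection_iff)
  note usa = unit_selfadj[OF n]
  have c: "p \<in> carrier_mat n n" using p by (rule proj_carrier)
  have s: "rscale V 2 p - unit_mat V n \<in> selfadj V n"
    using sa usa selfadj_minus selfadj_rscale by blast
  have "rscale V 2 (unit_mat V n - p) - unit_mat V n = - (rscale V 2 p - unit_mat V n)"
    unfolding rscale_two using c by (intro eq_matI) auto
  then show "unit_mat V n - p \<in> order_projections V n"
    using abs_uminus[OF n s] ab selfadj_minus[OF usa sa] by (simp add: order_projection_iff)
  show *: "p + (unit_mat V n - p) = unit_mat V n"
    using c by (intro eq_matI) auto
  have "p - (unit_mat V n - p) = rscale V 2 p - unit_mat V n"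
    unfolding rscale_two using c by (intro eq_matI) auto
  then show "orth V p (unit_mat V n - p)" using ab * by (simp add: orth_def)
qed

lemma proj_zero: "n \<ge> 1 \<Longrightarrow> 0\<^sub>m n n \<in> order_projections V n"
proof -
  assume n: "n \<ge> 1"
  have "rscale V 2 (0\<^sub>m n n) - unit_mat V n = - unit_mat V n"
    by (rule eq_matI) auto
  then show ?thesis
    using abs_uminus[OF n unit_selfadj[OF n]] abs_cone[OF n unit_in_cone[OF n]]
      cone_selfadj[OF n zero_in_cone[OF n]] by (simp add: order_projection_iff)
qed

lemma proj_unit: "n \<ge> 1 \<Longrightarrow> unit_mat V n \<in> order_projections V n"
proof -
  assume n: "n \<ge> 1"
  have "rscale V 2 (unit_mat V n) - unit_mat V n = unit_mat V n"
    unfolding rscale_two by (rule eq_matI) auto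
  then show ?thesis
    using abs_cone[OF n unit_in_cone[OF n]] unit_selfadj[OF n] by (simp add: order_projection_iff)
qed

lemma proj_dsum:
  assumes m: "m \<ge> 1" and n: "n \<ge> 1"
    and p: "p \<in> order_projections V m" and q: "q \<in> order_projections V n"
  shows "p \<oplus>\<^sub>m q \<in> order_projections V (m + n)"
proof -
  note c = proj_carrier[OF p] proj_carrier[OF q]
  have "rscale V 2 (p \<oplus>\<^sub>m q) - unit_mat V (m + n) =
      (rscale V 2 p - unit_mat V m) \<oplus>\<^sub>m (rscale V 2 q - unit_mat V n)"
    using dsum_minus[of "rscale V 2 p" m m "unit_mat V m" "rscale V 2 q" n n "unit_mat V n"] c
    by (simp add: rscale_dsum unit_dsum)
  then have "mabs V (rscale V 2 (p \<oplus>\<^sub>m q) - unit_mat V (m + n)) = unit_mat V m \<oplus>\<^sub>m unit_mat V n"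
    using p q c m n abs_dsum[of m m n n "rscale V 2 p - unit_mat V m" "rscale V 2 q - unit_mat V n"]
    by (simp add: order_projection_iff minus_carrier_mat)
  then show ?thesis
    using p q c dsum_carrier[OF c] by (simp add: order_projection_iff selfadj_def adj_dsum unit_dsum)
qed

section \<open>Equivalence of order projections\<close>

text \<open>Once both absolute values are known to be order projections, \<open>v\<close> is
  automatically a partial isometry.\<close>

lemma proj_equivI:
  assumes "p \<in> order_projections V m" "q \<in> order_projections V n" "v \<in> carrier_mat m n"
    and "mabs V (adj V v) = p" "mabs V v = q"
  shows "proj_equiv V p q"
  using assms proj_carrier[OF assms(1)] proj_carrier[OF assms(2)]
  unfolding proj_equiv_def partial_isometries_def by auto

lemma proj_equivE:
  assumes "proj_equiv V p q" "p \<in> order_projections V m" "q \<in> order_projections V n"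
  obtains v where "v \<in> carrier_mat m n" "mabs V (adj V v) = p" "mabs V v = q"
    "v \<in> partial_isometries V m n"
  using assms(1) proj_carrier[OF assms(2)] proj_carrier[OF assms(3)]
  unfolding proj_equiv_def partial_isometries_def by auto

lemma proj_equiv_refl: "n \<ge> 1 \<Longrightarrow> p \<in> order_projections V n \<Longrightarrow> proj_equiv V p p"
  by (rule proj_equivI[where v = p]) (auto simp: proj_abs proj_adj proj_carrier)

lemma proj_equiv_sym:
  assumes "p \<in> order_projections V m" "q \<in> order_projections V n" "proj_equiv V p q"
  shows "proj_equiv V q p"
proof -
  obtain v where "v \<in> carrier_mat m n" "mabs V (adj V v) = p" "mabs V v = q"
    using proj_equivE[OF assms(3,1,2)] .
  then show ?thesis using assms by (intro proj_equivI[where v = "adj V v"]) auto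
qed

lemma proj_equiv_trans:
  assumes T: "condition_T V" and ge: "m \<ge> 1" "n \<ge> 1" "l \<ge> 1"
    and p: "p \<in> order_projections V m" and q: "q \<in> order_projections V n"
    and r: "r \<in> order_projections V l"
    and pq: "proj_equiv V p q" and qr: "proj_equiv V q r"
  shows "proj_equiv V p r"
proof -
  obtain v where v: "mabs V (adj V v) = p" "mabs V v = q" "v \<in> partial_isometries V m n"
    using proj_equivE[OF pq p q] .
  \<comment> \<open>Condition (T) composes two partial isometries with the same \<open>mabs\<close>,
    so the equivalence of \<open>q\<close> and \<open>r\<close> is reversed to make \<open>q\<close>
    the common one.\<close>
  obtain u where u: "mabs V (adj V u) = r" "mabs V u = q" "u \<in> partial_isometries V l n"
    using proj_equivE[OF proj_equiv_sym[OF q r qr] r q] .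
  obtain w where "w \<in> partial_isometries V m l" "mabs V (adj V w) = p" "mabs V w = r"
    using T ge u v unfolding condition_T_def by metis
  then show ?thesis
    using p r by (intro proj_equivI[where v = w]) (auto simp: partial_isometries_def)
qed

lemma proj_equiv_dsum:
  assumes ge: "m \<ge> 1" "n \<ge> 1" "k \<ge> 1" "l \<ge> 1"
    and p: "p \<in> order_projections V m" "q \<in> order_projections V n"
    and p': "p' \<in> order_projections V k" "q' \<in> order_projections V l"
    and "proj_equiv V p q" "proj_equiv V p' q'"
  shows "proj_equiv V (p \<oplus>\<^sub>m p') (q \<oplus>\<^sub>m q')"
proof -
  obtain v where v: "v \<in> carrier_mat m n" "mabs V (adj V v) = p" "mabs V v = q"
    using proj_equivE[OF assms(9) p] .
  obtain w where w: "w \<in> carrier_mat k l" "mabs V (adj V w) = p'" "mabs V w = q'"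
    using proj_equivE[OF assms(10) p'] .
  show ?thesis
    using v w abs_dsum[OF ge v(1) w(1)] abs_dsum[OF ge(2,1,4,3) adj_carrier[OF v(1)] adj_carrier[OF w(1)]]
    by (intro proj_equivI[OF proj_dsum[OF ge(1,3) p(1) p'(1)] proj_dsum[OF ge(2,4) p(2) p'(2)],
      where v = "v \<oplus>\<^sub>m w"]) (auto simp: adj_dsum)
qed

lemma proj_equiv_dsum_commute:
  assumes ge: "m \<ge> 1" "n \<ge> 1"
    and p: "p \<in> order_projections V m" and q: "q \<in> order_projections V n"
  shows "proj_equiv V (p \<oplus>\<^sub>m q) (q \<oplus>\<^sub>m p)"
proof (rule proj_equivI[OF proj_dsum[OF ge p q] proj_dsum[OF ge(2,1) q p], where v = "antidiag p q"])
  note c = proj_carrier[OF p] proj_carrier[OF q]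
  show "antidiag p q \<in> carrier_mat (m + n) (n + m)"
    using antidiag_carrier[OF c] .
  show "mabs V (adj V (antidiag p q)) = p \<oplus>\<^sub>m q" "mabs V (antidiag p q) = q \<oplus>\<^sub>m p"
    using abs_antidiag[of m m n n p q] abs_antidiag[of n n m m q p] c p q ge
    by (simp_all add: adj_antidiag proj_abs proj_adj)
qed

text \<open>The column \<open>[0; p]\<close> is a partial isometry: its zero rows leave
  \<open>|p| = p\<close>, while its adjoint has absolute value \<open>0 \<oplus> p\<close>.\<close>

lemma proj_equiv_zero_dsum:
  assumes ge: "m \<ge> 1" "k \<ge> 1" and p: "p \<in> order_projections V m"
  shows "proj_equiv V (0\<^sub>m k k \<oplus>\<^sub>m p) p"
proof (rule proj_equivI[OF proj_dsum[OF ge(2,1) proj_zero[OF ge(2)] p] p, where v = "0\<^sub>m k m @\<^sub>r p"])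
  note c = proj_carrier[OF p]
  show "0\<^sub>m k m @\<^sub>r p \<in> carrier_mat (k + m) m" using c by auto
  show "mabs V (adj V (0\<^sub>m k m @\<^sub>r p)) = 0\<^sub>m k k \<oplus>\<^sub>m p" "mabs V (0\<^sub>m k m @\<^sub>r p) = p"
    using abs_append_zero(2)[OF ge(1,1) c] abs_adj_append_zero(2)[OF ge(1,1,2) c] p ge
    by (simp_all add: proj_abs proj_adj)
qed

lemma proj_equiv_zero_zero: "m \<ge> 1 \<Longrightarrow> n \<ge> 1 \<Longrightarrow> proj_equiv V (0\<^sub>m m m) (0\<^sub>m n n)"
  by (rule proj_equivI[OF proj_zero proj_zero, where v = "0\<^sub>m m n"]) (auto simp: abs_zero)

text \<open>The partial isometry is the column \<open>[p; e - p]\<close>, a sum of two orthogonal partial isometries.\<close>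

lemma proj_equiv_compl:
  assumes n: "n \<ge> 1" and p: "p \<in> order_projections V n"
  shows "proj_equiv V (p \<oplus>\<^sub>m (unit_mat V n - p)) (unit_mat V n)"
proof -
  let ?q = "unit_mat V n - p"
  note q = proj_compl(1)[OF n p]
  note c = proj_carrier[OF p] proj_carrier[OF q]
  let ?z = "0\<^sub>m n n :: 'a mat"
  let ?u = "p @\<^sub>r ?z" and ?v = "?z @\<^sub>r ?q"
  have car: "?u \<in> carrier_mat (n + n) n" "?v \<in> carrier_mat (n + n) n"
    using c by auto
  have ab: "mabs V ?u = p" "mabs V ?v = ?q"
    "mabs V (adj V ?u) = p \<oplus>\<^sub>m ?z" "mabs V (adj V ?v) = ?z \<oplus>\<^sub>m ?q"
    using abs_append_zero[OF n n] abs_adj_append_zero[OF n n n] c p q n by (simp_all add: proj_abs proj_adj)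
  have qsa: "?q \<in> selfadj V n" using q by (simp add: order_projection_iff)
  have sums: "(p \<oplus>\<^sub>m ?z) + (?z \<oplus>\<^sub>m ?q) = p \<oplus>\<^sub>m ?q"
    using dsum_add[of p n n ?z ?z n n ?q] c by simp
  \<comment> \<open>The sign of the second block disappears under the absolute value, so this
    difference has absolute value \<open>p \<oplus>\<^sub>m ?q\<close>, the sum of the two.\<close>
  have "(p \<oplus>\<^sub>m ?z) - (?z \<oplus>\<^sub>m ?q) = p \<oplus>\<^sub>m (- ?q)"
  proof -
    have "p - ?z = p" "?z - ?q = - ?q" using c by (auto intro!: eq_matI)
    then show ?thesis using dsum_minus[of p n n ?z ?z n n ?q] c by simp
  qed
  then have "orth V (p \<oplus>\<^sub>m ?z) (?z \<oplus>\<^sub>m ?q)"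
    using abs_dsum[of n n n n p "- ?q"] abs_uminus[OF n qsa] proj_abs[OF n p] proj_abs[OF n q] c n sums
    by (simp add: orth_def)
  \<comment> \<open>The absolute values of the adjoints are orthogonal by the preceding step; those
    of \<open>?u\<close> and \<open>?v\<close> are \<open>p\<close> and its complement, orthogonal
    by \<open>proj_compl\<close>.\<close>
  then have "mabs V (?u + ?v) = unit_mat V n" "mabs V (adj V (?u + ?v)) = p \<oplus>\<^sub>m ?q"
    using abs_add_orth[OF _ n car] n ab sums proj_compl(2,3)[OF n p] by simp_all
  then show ?thesis
    using car by (intro proj_equivI[OF proj_dsum[OF n n p q] proj_unit[OF n], where v = "?u + ?v"]) auto
qed

end

section \<open>Stable classes and the Grothendieck group\<close>

locale absolute_matrix_order_unit_space_T = absolute_matrix_order_unit_space +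
  assumes T: "condition_T V"
begin

abbreviation "OP \<equiv> order_projections_inf V"

abbreviation zproj :: "'a mat" where "zproj \<equiv> 0\<^sub>m 1 1"

text \<open>Membership in \<open>OP\<close> is included so that this is an equivalence relation on
  \<open>OP\<close> and chains of equivalences carry it along.\<close>

definition equivalent :: "'a mat \<Rightarrow> 'a mat \<Rightarrow> bool" (infix "\<simeq>" 50) where
  "p \<simeq> q \<longleftrightarrow> p \<in> OP \<and> q \<in> OP \<and> proj_equiv V p q"

lemma OP_I: "n \<ge> 1 \<Longrightarrow> p \<in> order_projections V n \<Longrightarrow> p \<in> OP"
  by (auto simp: order_projections_inf_def)

lemma OP_E:
  assumes "p \<in> OP"
  obtains n where "n \<ge> 1" "p \<in> order_projections V n"
  using assms by (auto simp: order_projections_inf_def)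

lemma OP_dsum [simp, intro]:
  assumes "p \<in> OP" "q \<in> OP"
  shows "p \<oplus>\<^sub>m q \<in> OP"
proof -
  obtain m n where "m \<ge> 1" "p \<in> order_projections V m" "n \<ge> 1" "q \<in> order_projections V n"
    using assms OP_E by metis
  then show ?thesis using proj_dsum OP_I[of "m + n"] by simp
qed

lemma OP_zero: "n \<ge> 1 \<Longrightarrow> 0\<^sub>m n n \<in> OP"
  using proj_zero OP_I by blast

lemma OP_zproj [simp]: "zproj \<in> OP"
  using OP_zero[of 1] by simp

declare OP_zproj [simplified, simp]

lemma equivalent_OP: "p \<simeq> q \<Longrightarrow> p \<in> OP" "p \<simeq> q \<Longrightarrow> q \<in> OP"
  by (auto simp: equivalent_def)

lemma equivalent_refl [simp]: "p \<in> OP \<Longrightarrow> p \<simeq> p"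
  by (auto simp: equivalent_def elim: OP_E intro: proj_equiv_refl)

lemma equivalent_sym: "p \<simeq> q \<Longrightarrow> q \<simeq> p"
  by (auto simp: equivalent_def elim!: OP_E intro: proj_equiv_sym)

lemma equivalent_trans [trans]:
  assumes "p \<simeq> q" "q \<simeq> r"
  shows "p \<simeq> r"
proof -
  obtain l m n where "l \<ge> 1" "p \<in> order_projections V l" "m \<ge> 1" "q \<in> order_projections V m"
    "n \<ge> 1" "r \<in> order_projections V n"
    using assms OP_E unfolding equivalent_def by metis
  then show ?thesis using assms proj_equiv_trans[OF T] unfolding equivalent_def by blast
qed

lemma equivalent_dsum:
  assumes "p \<simeq> q" "r \<simeq> s"
  shows "p \<oplus>\<^sub>m r \<simeq> q \<oplus>\<^sub>m s"
proof -
  obtain k l m n where "k \<ge> 1" "p \<in> order_projections V k" "l \<ge> 1" "q \<in> order_projections V l"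
    "m \<ge> 1" "r \<in> order_projections V m" "n \<ge> 1" "s \<in> order_projections V n"
    using assms OP_E unfolding equivalent_def by metis
  then show ?thesis using assms proj_equiv_dsum OP_dsum unfolding equivalent_def by blast
qed

lemma equivalent_commute: "p \<in> OP \<Longrightarrow> q \<in> OP \<Longrightarrow> p \<oplus>\<^sub>m q \<simeq> q \<oplus>\<^sub>m p"
  by (auto simp: equivalent_def elim!: OP_E intro: proj_equiv_dsum_commute dest: OP_I)

lemma equivalent_zero_dsum: "p \<in> OP \<Longrightarrow> k \<ge> 1 \<Longrightarrow> 0\<^sub>m k k \<oplus>\<^sub>m p \<simeq> p"
  using OP_dsum[OF OP_zero] proj_equiv_zero_dsum by (metis equivalent_def OP_E)

lemma equivalent_zero_zero: "m \<ge> 1 \<Longrightarrow> n \<ge> 1 \<Longrightarrow> 0\<^sub>m m m \<simeq> 0\<^sub>m n n"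
  using OP_zero proj_equiv_zero_zero by (auto simp: equivalent_def)

lemma equivalent_compl: "n \<ge> 1 \<Longrightarrow> p \<in> order_projections V n \<Longrightarrow> p \<oplus>\<^sub>m (unit_mat V n - p) \<simeq> unit_mat V n"
  using proj_equiv_compl proj_compl(1) proj_unit OP_I OP_dsum by (auto simp: equivalent_def)

section \<open>The cancellative monoid of stable classes\<close>

definition stable_class :: "'a mat \<Rightarrow> 'a mat set" where
  "stable_class p = {q \<in> OP. stably_equiv V p q}"

text \<open>The product is a union over representatives, as in \<open>K0\<close>; it is a single
  class once independence of the representatives is shown.\<close>

definition stable_monoid :: "'a mat set monoid" where
  "stable_monoid = \<lparr>carrier = stable_class ` OP,
     monoid.mult = (\<lambda>A B. \<Union>a\<in>A. \<Union>b\<in>B. stable_class (a \<oplus>\<^sub>m b)),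
     monoid.one = stable_class zproj\<rparr>"

lemma stably_equiv_iff:
  "p \<in> OP \<Longrightarrow> q \<in> OP \<Longrightarrow> stably_equiv V p q \<longleftrightarrow> (\<exists>r \<in> OP. p \<oplus>\<^sub>m r \<simeq> q \<oplus>\<^sub>m r)"
  by (auto simp: stably_equiv_def equivalent_def)

lemma stably_equiv_if_equivalent: "p \<simeq> q \<Longrightarrow> stably_equiv V p q"
  using stably_equiv_iff[OF equivalent_OP] equivalent_dsum[OF _ equivalent_refl[OF OP_zproj]] OP_zproj
  by blast

lemma stably_equiv_sym: "p \<in> OP \<Longrightarrow> q \<in> OP \<Longrightarrow> stably_equiv V p q \<Longrightarrow> stably_equiv V q p"
  by (auto simp: stably_equiv_iff intro: equivalent_sym)

lemma stably_equiv_trans: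
  assumes OP: "p \<in> OP" "q \<in> OP" "t \<in> OP" and "stably_equiv V p q" "stably_equiv V q t"
  shows "stably_equiv V p t"
proof -
  obtain r where r: "r \<in> OP" "p \<oplus>\<^sub>m r \<simeq> q \<oplus>\<^sub>m r"
    using assms(4) unfolding stably_equiv_iff[OF OP(1,2)] ..
  obtain s where s: "s \<in> OP" "q \<oplus>\<^sub>m s \<simeq> t \<oplus>\<^sub>m s"
    using assms(5) unfolding stably_equiv_iff[OF OP(2,3)] ..
  \<comment> \<open>If \<open>r\<close> stabilises the first equivalence and \<open>s\<close> the
    second, then \<open>r \<oplus>\<^sub>m s\<close> stabilises both; commutativity up to \<simeq>
    brings the required summand next to the projection being replaced.\<close>
  have "p \<oplus>\<^sub>m (r \<oplus>\<^sub>m s) = (p \<oplus>\<^sub>m r) \<oplus>\<^sub>m s" by (simp add: dsum_assoc)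
  also have "\<dots> \<simeq> (q \<oplus>\<^sub>m r) \<oplus>\<^sub>m s"
    by (rule equivalent_dsum[OF r(2) equivalent_refl[OF s(1)]])
  also have "\<dots> = q \<oplus>\<^sub>m (r \<oplus>\<^sub>m s)" by (simp add: dsum_assoc)
  also have "\<dots> \<simeq> q \<oplus>\<^sub>m (s \<oplus>\<^sub>m r)"
    by (rule equivalent_dsum[OF equivalent_refl[OF OP(2)] equivalent_commute[OF r(1) s(1)]])
  also have "\<dots> = (q \<oplus>\<^sub>m s) \<oplus>\<^sub>m r" by (simp add: dsum_assoc)
  also have "\<dots> \<simeq> (t \<oplus>\<^sub>m s) \<oplus>\<^sub>m r"
    by (rule equivalent_dsum[OF s(2) equivalent_refl[OF r(1)]])
  also have "\<dots> = t \<oplus>\<^sub>m (s \<oplus>\<^sub>m r)" by (simp add: dsum_assoc)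
  also have "\<dots> \<simeq> t \<oplus>\<^sub>m (r \<oplus>\<^sub>m s)"
    by (rule equivalent_dsum[OF equivalent_refl[OF OP(3)] equivalent_commute[OF s(1) r(1)]])
  finally show ?thesis
    unfolding stably_equiv_iff[OF OP(1,3)] using OP_dsum[OF r(1) s(1)] by blast
qed

lemma stable_class_eq_iff:
  assumes OP: "p \<in> OP" "q \<in> OP"
  shows "stable_class p = stable_class q \<longleftrightarrow> stably_equiv V p q"
proof
  assume "stable_class p = stable_class q"
  moreover have "q \<in> stable_class q"
    using OP stably_equiv_if_equivalent by (simp add: stable_class_def)
  ultimately show "stably_equiv V p q" by (auto simp: stable_class_def)
next
  assume pq: "stably_equiv V p q"
  show "stable_class p = stable_class q"
    using stably_equiv_trans[OF OP _ pq] stably_equiv_trans[OF OP(2,1) _ stably_equiv_sym[OF OP pq]]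
    by (auto simp: stable_class_def)
qed

lemma stable_class_eqI: "p \<simeq> q \<Longrightarrow> stable_class p = stable_class q"
  using equivalent_OP[of p q] by (simp add: stable_class_eq_iff stably_equiv_if_equivalent)

lemma stable_class_commute: "p \<in> OP \<Longrightarrow> q \<in> OP \<Longrightarrow> stable_class (p \<oplus>\<^sub>m q) = stable_class (q \<oplus>\<^sub>m p)"
  by (rule stable_class_eqI[OF equivalent_commute])

text \<open>The summand \<open>r\<close> witnessing equality of the classes of \<open>p\<close> and
  \<open>q\<close> still serves after \<open>t\<close> has been moved past it.\<close>

lemma stable_class_dsum_left:
  assumes OP: "p \<in> OP" "q \<in> OP" "t \<in> OP" and "stable_class p = stable_class q"
  shows "stable_class (p \<oplus>\<^sub>m t) = stable_class (q \<oplus>\<^sub>m t)"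
proof -
  obtain r where r: "r \<in> OP" "p \<oplus>\<^sub>m r \<simeq> q \<oplus>\<^sub>m r"
    using assms(4) unfolding stable_class_eq_iff[OF OP(1,2)] stably_equiv_iff[OF OP(1,2)] ..
  have "(p \<oplus>\<^sub>m t) \<oplus>\<^sub>m r = p \<oplus>\<^sub>m (t \<oplus>\<^sub>m r)" by (simp add: dsum_assoc)
  also have "\<dots> \<simeq> p \<oplus>\<^sub>m (r \<oplus>\<^sub>m t)"
    by (rule equivalent_dsum[OF equivalent_refl[OF OP(1)] equivalent_commute[OF OP(3) r(1)]])
  also have "\<dots> = (p \<oplus>\<^sub>m r) \<oplus>\<^sub>m t" by (simp add: dsum_assoc)
  also have "\<dots> \<simeq> (q \<oplus>\<^sub>m r) \<oplus>\<^sub>m t"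
    by (rule equivalent_dsum[OF r(2) equivalent_refl[OF OP(3)]])
  also have "\<dots> = q \<oplus>\<^sub>m (r \<oplus>\<^sub>m t)" by (simp add: dsum_assoc)
  also have "\<dots> \<simeq> q \<oplus>\<^sub>m (t \<oplus>\<^sub>m r)"
    by (rule equivalent_dsum[OF equivalent_refl[OF OP(2)] equivalent_commute[OF r(1) OP(3)]])
  also have "\<dots> = (q \<oplus>\<^sub>m t) \<oplus>\<^sub>m r" by (simp add: dsum_assoc)
  finally have "stably_equiv V (p \<oplus>\<^sub>m t) (q \<oplus>\<^sub>m t)"
    using r OP by (auto simp: stably_equiv_iff)
  then show ?thesis using OP by (simp add: stable_class_eq_iff)
qed

lemma stable_class_mult:
  assumes OP: "p \<in> OP" "q \<in> OP"
  shows "stable_class p \<otimes>\<^bsub>stable_monoid\<^esub> stable_class q = stable_class (p \<oplus>\<^sub>m q)"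
proof -
  have eq: "stable_class (a \<oplus>\<^sub>m b) = stable_class (p \<oplus>\<^sub>m q)"
    if a: "a \<in> stable_class p" and b: "b \<in> stable_class q" for a b
  proof -
    have ab: "a \<in> OP" "b \<in> OP" "stable_class a = stable_class p" "stable_class b = stable_class q"
      using a b OP stably_equiv_sym stable_class_eq_iff[of a p] stable_class_eq_iff[of b q]
      by (simp_all add: stable_class_def)
    show ?thesis
      using stable_class_dsum_left[of a p b] stable_class_dsum_left[of b q p] ab OP
        stable_class_commute[of p b] stable_class_commute[of p q] by simp
  qed
  \<comment> \<open>A union of copies of one class is that class only if the index sets are
    nonempty.\<close>
  have ne: "stable_class p \<noteq> {}" "stable_class q \<noteq> {}"
    using OP stably_equiv_if_equivalent[OF equivalent_refl] by (auto simp: stable_class_def)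
  have "stable_class p \<otimes>\<^bsub>stable_monoid\<^esub> stable_class q =
      (\<Union>a\<in>stable_class p. \<Union>b\<in>stable_class q. stable_class (p \<oplus>\<^sub>m q))"
    using eq by (simp add: stable_monoid_def)
  then show ?thesis using ne by simp
qed

lemma comm_monoid_stable: "comm_monoid stable_monoid"
proof (rule comm_monoidI)
  have car: "carrier stable_monoid = stable_class ` OP" and one: "\<one>\<^bsub>stable_monoid\<^esub> = stable_class zproj"
    by (simp_all add: stable_monoid_def)
  show "\<one>\<^bsub>stable_monoid\<^esub> \<in> carrier stable_monoid" by (simp add: car one)
  fix x assume "x \<in> carrier stable_monoid"
  then obtain p where x: "p \<in> OP" "x = stable_class p" by (auto simp: car)
  show "\<one>\<^bsub>stable_monoid\<^esub> \<otimes>\<^bsub>stable_monoid\<^esub> x = x"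
    using x stable_class_eqI[OF equivalent_zero_dsum[of p 1]] by (simp add: one stable_class_mult)
  fix y assume "y \<in> carrier stable_monoid"
  then obtain q where y: "q \<in> OP" "y = stable_class q" by (auto simp: car)
  show "x \<otimes>\<^bsub>stable_monoid\<^esub> y \<in> carrier stable_monoid"
    using x y by (simp add: car stable_class_mult)
  show "x \<otimes>\<^bsub>stable_monoid\<^esub> y = y \<otimes>\<^bsub>stable_monoid\<^esub> x"
    using x y stable_class_commute by (simp add: stable_class_mult)
  fix z assume "z \<in> carrier stable_monoid"
  then obtain r where z: "r \<in> OP" "z = stable_class r" by (auto simp: car)
  show "x \<otimes>\<^bsub>stable_monoid\<^esub> y \<otimes>\<^bsub>stable_monoid\<^esub> z = x \<otimes>\<^bsub>stable_monoid\<^esub> (y \<otimes>\<^bsub>stable_monoid\<^esub> z)"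
    using x y z by (simp add: stable_class_mult dsum_assoc)
qed

interpretation M: comm_monoid stable_monoid
  by (rule comm_monoid_stable)

abbreviation stable_mult :: "'a mat set \<Rightarrow> 'a mat set \<Rightarrow> 'a mat set" (infixl "\<star>" 70) where
  "x \<star> y \<equiv> x \<otimes>\<^bsub>stable_monoid\<^esub> y"

lemma stable_class_carrier [simp]: "p \<in> OP \<Longrightarrow> stable_class p \<in> carrier stable_monoid"
  by (simp add: stable_monoid_def)

text \<open>The cancelled summand is absorbed into the stabiliser: an equivalence of
  \<open>p \<oplus>\<^sub>m r\<close> and \<open>q \<oplus>\<^sub>m r\<close> after adding
  \<open>s\<close> is one of \<open>p\<close> and \<open>q\<close> after adding
  \<open>r \<oplus>\<^sub>m s\<close>.\<close>

lemma stable_cancel: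
  assumes "x \<in> carrier stable_monoid" "y \<in> carrier stable_monoid" "z \<in> carrier stable_monoid"
    and eq: "x \<star> z = y \<star> z"
  shows "x = y"
proof -
  obtain p q r where pqr: "p \<in> OP" "q \<in> OP" "r \<in> OP"
    and xyz: "x = stable_class p" "y = stable_class q" "z = stable_class r"
    using assms by (auto simp: stable_monoid_def)
  then have "stably_equiv V (p \<oplus>\<^sub>m r) (q \<oplus>\<^sub>m r)"
    using eq stable_class_eq_iff[of "p \<oplus>\<^sub>m r" "q \<oplus>\<^sub>m r"] by (simp add: stable_class_mult)
  then obtain s where "s \<in> OP" "p \<oplus>\<^sub>m (r \<oplus>\<^sub>m s) \<simeq> q \<oplus>\<^sub>m (r \<oplus>\<^sub>m s)"
    using stably_equiv_iff[of "p \<oplus>\<^sub>m r" "q \<oplus>\<^sub>m r"] pqr by (auto simp: dsum_assoc)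
  then have "stably_equiv V p q"
    unfolding stably_equiv_iff[OF pqr(1,2)] using OP_dsum[OF pqr(3)] by blast
  then show ?thesis using pqr xyz by (simp add: stable_class_eq_iff)
qed

section \<open>The group of differences\<close>

text \<open>Moves the relation from matrices to the commutative monoid of stable classes, where
  rearrangement is plain associativity and commutativity.\<close>

lemma K0_rel_iff:
  "((p1, q1), (p2, q2)) \<in> K0_rel V \<longleftrightarrow> p1 \<in> OP \<and> q1 \<in> OP \<and> p2 \<in> OP \<and> q2 \<in> OP \<and>
     stable_class p1 \<star> stable_class q2 = stable_class p2 \<star> stable_class q1"
proof (cases "p1 \<in> OP \<and> q1 \<in> OP \<and> p2 \<in> OP \<and> q2 \<in> OP")
  case True
  then show ?thesis
    using stable_class_eq_iff[of "p1 \<oplus>\<^sub>m q2" "p2 \<oplus>\<^sub>m q1"] by (auto simp: K0_rel_def stable_class_mult)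
qed (auto simp: K0_rel_def)

lemma equiv_K0_rel: "equiv (OP \<times> OP) (K0_rel V)"
proof (rule equivI)
  show "K0_rel V \<subseteq> (OP \<times> OP) \<times> (OP \<times> OP)" by (auto simp: K0_rel_def)
  show "refl_on (OP \<times> OP) (K0_rel V)" by (auto simp: refl_on_def K0_rel_iff)
  show "sym (K0_rel V)" by (auto simp: sym_def K0_rel_iff)
  show "trans (K0_rel V)"
  proof (rule transI)
    fix x y z assume xyz: "(x, y) \<in> K0_rel V" "(y, z) \<in> K0_rel V"
    obtain p1 q1 p2 q2 p3 q3 where x: "x = (p1, q1)" and y: "y = (p2, q2)" and z: "z = (p3, q3)"
      by (metis surj_pair)
    let ?c = stable_class
    have OP: "p1 \<in> OP" "q1 \<in> OP" "p2 \<in> OP" "q2 \<in> OP" "p3 \<in> OP" "q3 \<in> OP"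
      and e1: "?c p1 \<star> ?c q2 = ?c p2 \<star> ?c q1" and e2: "?c p2 \<star> ?c q3 = ?c p3 \<star> ?c q2"
      using xyz by (auto simp: x y z K0_rel_iff)
    \<comment> \<open>Multiplying the two equations yields the desired one up to the factor
      \<open>?c p2 \<star> ?c q2\<close>, which is then cancelled.\<close>
    have "?c p1 \<star> ?c q3 \<star> (?c p2 \<star> ?c q2) = (?c p1 \<star> ?c q2) \<star> (?c p2 \<star> ?c q3)"
      using OP by (simp add: M.m_ac)
    also have "\<dots> = ?c p3 \<star> ?c q1 \<star> (?c p2 \<star> ?c q2)"
      unfolding e1 e2 using OP by (simp add: M.m_ac)
    finally have "?c p1 \<star> ?c q3 = ?c p3 \<star> ?c q1"
      by (rule stable_cancel[rotated 3]) (use OP in simp_all)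
    then show "(x, z) \<in> K0_rel V" using OP by (simp add: x z K0_rel_iff)
  qed
qed

lemma K0_class_eq_iff:
  assumes "p1 \<in> OP" "q1 \<in> OP" "p2 \<in> OP" "q2 \<in> OP"
  shows "K0_class V p1 q1 = K0_class V p2 q2 \<longleftrightarrow>
    stable_class p1 \<star> stable_class q2 = stable_class p2 \<star> stable_class q1"
  using eq_equiv_class_iff[OF equiv_K0_rel, of "(p1, q1)" "(p2, q2)"] assms
  by (simp add: K0_class_def K0_rel_iff)

lemma K0_carrier: "carrier (K0 V) = {K0_class V p q | p q. p \<in> OP \<and> q \<in> OP}"
  by (auto simp: K0_def quotient_def K0_class_def)

lemma K0_class_in_carrier [simp]: "p \<in> OP \<Longrightarrow> q \<in> OP \<Longrightarrow> K0_class V p q \<in> carrier (K0 V)"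
  unfolding K0_carrier by blast

lemma K0_one: "\<one>\<^bsub>K0 V\<^esub> = K0_class V zproj zproj"
  by (simp add: K0_def)

lemma K0_mult:
  assumes OP: "p1 \<in> OP" "q1 \<in> OP" "p2 \<in> OP" "q2 \<in> OP"
  shows "K0_class V p1 q1 \<otimes>\<^bsub>K0 V\<^esub> K0_class V p2 q2 = K0_class V (p1 \<oplus>\<^sub>m p2) (q1 \<oplus>\<^sub>m q2)"
proof -
  let ?c = stable_class
  have eq: "K0_class V (a \<oplus>\<^sub>m c) (b \<oplus>\<^sub>m d) = K0_class V (p1 \<oplus>\<^sub>m p2) (q1 \<oplus>\<^sub>m q2)"
    if ab: "(a, b) \<in> K0_class V p1 q1" and cd: "(c, d) \<in> K0_class V p2 q2" for a b c d
  proof -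
    have OP': "a \<in> OP" "b \<in> OP" "c \<in> OP" "d \<in> OP"
      and e: "?c a \<star> ?c q1 = ?c p1 \<star> ?c b" "?c c \<star> ?c q2 = ?c p2 \<star> ?c d"
      using ab cd by (auto simp: K0_class_def K0_rel_iff)
    \<comment> \<open>Independence of the representatives follows by multiplying the two equations
      in \<open>e\<close>.\<close>
    have "?c a \<star> ?c c \<star> (?c q1 \<star> ?c q2) = (?c a \<star> ?c q1) \<star> (?c c \<star> ?c q2)"
      using OP OP' by (simp add: M.m_ac)
    also have "\<dots> = ?c p1 \<star> ?c p2 \<star> (?c b \<star> ?c d)"
      unfolding e using OP OP' by (simp add: M.m_ac)
    finally show ?thesis using OP OP' by (simp add: K0_class_eq_iff stable_class_mult[symmetric])
  qed
  have "K0_class V p1 q1 \<otimes>\<^bsub>K0 V\<^esub> K0_class V p2 q2 =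
      (\<Union>x\<in>K0_class V p1 q1. \<Union>y\<in>K0_class V p2 q2. K0_class V (p1 \<oplus>\<^sub>m p2) (q1 \<oplus>\<^sub>m q2))"
    using eq by (simp add: K0_def case_prod_beta)
  moreover have "(p1, q1) \<in> K0_class V p1 q1" "(p2, q2) \<in> K0_class V p2 q2"
    using OP by (auto simp: K0_class_def K0_rel_iff)
  then have "K0_class V p1 q1 \<noteq> {}" "K0_class V p2 q2 \<noteq> {}"
    by blast+
  ultimately show ?thesis by simp
qed

text \<open>Zero matrices of different sizes are distinct matrices, but they share one stable
  class.\<close>

lemma stable_class_zero: "n \<ge> 1 \<Longrightarrow> stable_class (0\<^sub>m n n) = \<one>\<^bsub>stable_monoid\<^esub>"
  using stable_class_eqI[OF equivalent_zero_zero[of n 1]] by (simp add: stable_monoid_def)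

text \<open>These rules reduce an equation between classes of pairs to an identity in the
  commutative monoid of stable classes.\<close>

lemmas K0_simps = K0_class_eq_iff stable_class_mult[symmetric] stable_class_zero M.m_ac

lemma comm_group_K0: "comm_group (K0 V)"
proof (rule comm_groupI)
  show "\<one>\<^bsub>K0 V\<^esub> \<in> carrier (K0 V)"
    by (simp add: K0_one)
  fix x assume "x \<in> carrier (K0 V)"
  then obtain p1 q1 where x: "p1 \<in> OP" "q1 \<in> OP" "x = K0_class V p1 q1" unfolding K0_carrier by auto
  show "\<one>\<^bsub>K0 V\<^esub> \<otimes>\<^bsub>K0 V\<^esub> x = x"
    using x by (simp add: K0_one K0_mult K0_simps)
  have "K0_class V q1 p1 \<otimes>\<^bsub>K0 V\<^esub> x = \<one>\<^bsub>K0 V\<^esub>"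
    using x by (simp add: K0_one K0_mult K0_simps)
  then show "\<exists>y\<in>carrier (K0 V). y \<otimes>\<^bsub>K0 V\<^esub> x = \<one>\<^bsub>K0 V\<^esub>"
    using x(1,2) K0_class_in_carrier by blast
  fix y assume "y \<in> carrier (K0 V)"
  then obtain p2 q2 where y: "p2 \<in> OP" "q2 \<in> OP" "y = K0_class V p2 q2" unfolding K0_carrier by auto
  show "x \<otimes>\<^bsub>K0 V\<^esub> y \<in> carrier (K0 V)"
    using x y by (simp add: K0_mult)
  show "x \<otimes>\<^bsub>K0 V\<^esub> y = y \<otimes>\<^bsub>K0 V\<^esub> x"
    using x y by (simp add: K0_mult K0_simps)
  fix z assume "z \<in> carrier (K0 V)"
  then obtain p3 q3 where z: "p3 \<in> OP" "q3 \<in> OP" "z = K0_class V p3 q3" unfolding K0_carrier by auto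
  show "x \<otimes>\<^bsub>K0 V\<^esub> y \<otimes>\<^bsub>K0 V\<^esub> z = x \<otimes>\<^bsub>K0 V\<^esub> (y \<otimes>\<^bsub>K0 V\<^esub> z)"
    using x y z by (simp add: K0_mult dsum_assoc)
qed

lemma K0_inv: "p \<in> OP \<Longrightarrow> q \<in> OP \<Longrightarrow> inv\<^bsub>K0 V\<^esub> K0_class V p q = K0_class V q p"
  by (rule group.inv_equality[OF comm_group.axioms(2)[OF comm_group_K0]])
    (simp_all add: K0_one K0_mult K0_simps)

section \<open>The positive cone of the group\<close>

lemma group_cone_K0_pos: "group_cone (K0 V) (K0_pos V)"
  unfolding group_cone_def
proof (intro conjI ballI)
  show "comm_group (K0 V)" by (rule comm_group_K0)
  show "K0_pos V \<subseteq> carrier (K0 V)" unfolding K0_pos_def using OP_zproj K0_class_in_carrier by blast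
  show "\<one>\<^bsub>K0 V\<^esub> \<in> K0_pos V" unfolding K0_pos_def K0_one using OP_zproj by blast
  fix x y assume "x \<in> K0_pos V" "y \<in> K0_pos V"
  then obtain p q where pq: "p \<in> OP" "q \<in> OP" and xy: "x = K0_class V p zproj" "y = K0_class V q zproj"
    unfolding K0_pos_def by auto
  have "x \<otimes>\<^bsub>K0 V\<^esub> y = K0_class V (p \<oplus>\<^sub>m q) zproj"
    using pq by (simp add: xy K0_mult K0_simps)
  then show "x \<otimes>\<^bsub>K0 V\<^esub> y \<in> K0_pos V" unfolding K0_pos_def using pq OP_dsum by blast
qed

lemma generating_cone_K0_pos: "generating_cone (K0 V) (K0_pos V)"
proof -
  \<comment> \<open>Any class of a pair is a difference of positive classes, because inversion swaps
    the entries of a pair.\<close>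
  have "K0_class V p zproj \<otimes>\<^bsub>K0 V\<^esub> inv\<^bsub>K0 V\<^esub> K0_class V q zproj = K0_class V p q" if "p \<in> OP" "q \<in> OP" for p q
    using that by (simp add: K0_inv K0_mult K0_simps)
  then show ?thesis
    unfolding generating_cone_def K0_carrier K0_pos_def by (auto 4 4) metis+
qed

text \<open>Adding the complements of \<open>r\<close> and \<open>p\<close> turns \<open>p \<oplus> r \<sim> 0 \<oplus> r\<close> into an equivalence
  of \<open>e\<close> with the subprojection \<open>(e - p) \<oplus> e\<close>.\<close>

lemma stably_zero_eq_zero:
  assumes fin: "\<forall>n\<ge>1. finite_projection V n (unit_mat V n)"
    and m: "m \<ge> 1" and p: "p \<in> order_projections V m"
    and k: "k \<ge> 1" and st: "stably_equiv V p (0\<^sub>m k k)"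
  shows "p = 0\<^sub>m m m"
proof -
  let ?e = "unit_mat V"
  let ?q = "?e m - p"
  have pOP: "p \<in> OP" using m p OP_I by blast
  obtain r where r: "r \<in> OP" and pr: "p \<oplus>\<^sub>m r \<simeq> 0\<^sub>m k k \<oplus>\<^sub>m r"
    using st stably_equiv_iff[OF pOP OP_zero[OF k]] by blast
  obtain n where n: "n \<ge> 1" and rn: "r \<in> order_projections V n" using r OP_E by blast
  let ?s = "?e n - r"
  note compl = proj_compl[OF m p] proj_compl[OF n rn]
  have OP': "?q \<in> OP" "?s \<in> OP" "?e n \<in> OP" "?e m \<in> OP"
    using compl OP_I m n proj_unit by blast+
  have rs: "r \<oplus>\<^sub>m ?s \<simeq> ?e n" using equivalent_compl[OF n rn] .
  \<comment> \<open>Completing \<open>r\<close> by its complement replaces \<open>r\<close> by the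
    unit of size \<open>n\<close>, which then absorbs \<open>p\<close>.\<close>
  have "p \<oplus>\<^sub>m ?e n \<simeq> p \<oplus>\<^sub>m (r \<oplus>\<^sub>m ?s)"
    using equivalent_dsum[OF equivalent_refl[OF pOP] equivalent_sym[OF rs]] .
  also have "\<dots> = (p \<oplus>\<^sub>m r) \<oplus>\<^sub>m ?s" by (simp only: dsum_assoc)
  also have "\<dots> \<simeq> (0\<^sub>m k k \<oplus>\<^sub>m r) \<oplus>\<^sub>m ?s" by (rule equivalent_dsum[OF pr equivalent_refl[OF OP'(2)]])
  also have "\<dots> = 0\<^sub>m k k \<oplus>\<^sub>m (r \<oplus>\<^sub>m ?s)" by (simp only: dsum_assoc)
  also have "\<dots> \<simeq> r \<oplus>\<^sub>m ?s" by (rule equivalent_zero_dsum[OF OP_dsum[OF r OP'(2)] k])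
  also note rs
  finally have pe: "p \<oplus>\<^sub>m ?e n \<simeq> ?e n" .
  have "?q \<oplus>\<^sub>m ?e n \<simeq> ?q \<oplus>\<^sub>m (p \<oplus>\<^sub>m ?e n)"
    by (rule equivalent_dsum[OF equivalent_refl[OF OP'(1)] equivalent_sym[OF pe]])
  also have "\<dots> = (?q \<oplus>\<^sub>m p) \<oplus>\<^sub>m ?e n" by (simp only: dsum_assoc)
  also have "\<dots> \<simeq> (p \<oplus>\<^sub>m ?q) \<oplus>\<^sub>m ?e n"
    by (rule equivalent_dsum[OF equivalent_commute[OF OP'(1) pOP] equivalent_refl[OF OP'(3)]])
  also have "\<dots> \<simeq> ?e m \<oplus>\<^sub>m ?e n"
    by (rule equivalent_dsum[OF equivalent_compl[OF m p] equivalent_refl[OF OP'(3)]])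
  also have "\<dots> = ?e (m + n)" by (rule unit_dsum)
  finally have equ: "proj_equiv V (?q \<oplus>\<^sub>m ?e n) (?e (m + n))" by (simp add: equivalent_def)
  have pc: "p \<in> carrier_mat m m" "?q \<in> carrier_mat m m" using proj_carrier p compl(1) by auto
  have eq: "?e m - ?q = p" using pc by (intro eq_matI) auto
  \<comment> \<open>The difference is the projection \<open>p \<oplus> 0\<close>, hence positive, so
    \<open>?q \<oplus>\<^sub>m ?e n\<close> lies below the unit of size \<open>m + n\<close>.
    Finiteness at that size then forces equality.\<close>
  have "?e (m + n) - (?q \<oplus>\<^sub>m ?e n) = (?e m - ?q) \<oplus>\<^sub>m (?e n - ?e n)"
    unfolding unit_dsum[symmetric] using pc by (intro dsum_minus) auto
  also note eq
  also have "?e n - ?e n = 0\<^sub>m n n" by (rule eq_matI) auto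
  finally have "?e (m + n) - (?q \<oplus>\<^sub>m ?e n) \<in> mcone V (m + n)"
    using proj_in_cone[OF _ proj_dsum[OF m n p proj_zero[OF n]]] m by simp
  moreover have "?q \<oplus>\<^sub>m ?e n \<in> order_projections V (m + n)"
    by (rule proj_dsum[OF m n compl(1) proj_unit[OF n]])
  ultimately have "?q \<oplus>\<^sub>m ?e n = ?e (m + n)"
    using fin m equ unfolding finite_projection_def by (metis le_add1 order_trans)
  then have "?q = ?e m"
    using dsum_inject(1)[OF pc(2) unit_carrier unit_carrier unit_carrier] unit_dsum by metis
  with eq have "p = ?e m - ?e m" by simp
  then show ?thesis by simp
qed

text \<open>If the class of \<open>(p, 0)\<close> is the inverse of that of \<open>(q, 0)\<close>,
  then \<open>p \<oplus>\<^sub>m q\<close> is stably equivalent to 0. Finiteness makes it zero, so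
  its block \<open>p\<close> is zero.\<close>

lemma proper_cone_K0_pos:
  assumes fin: "\<forall>n\<ge>1. finite_projection V n (unit_mat V n)"
  shows "proper_cone (K0 V) (K0_pos V)"
  unfolding proper_cone_def
proof (intro equalityI subsetI)
  fix x assume "x \<in> K0_pos V \<inter> (\<lambda>x. inv\<^bsub>K0 V\<^esub> x) ` K0_pos V"
  then obtain p q where pq: "p \<in> OP" "q \<in> OP" and x: "x = K0_class V p zproj"
    "x = inv\<^bsub>K0 V\<^esub> K0_class V q zproj"
    by (auto simp: K0_pos_def)
  obtain m n where mn: "m \<ge> 1" "n \<ge> 1" "p \<in> order_projections V m" "q \<in> order_projections V n"
    using pq OP_E by metis
  have "K0_class V p zproj = K0_class V zproj q" using x pq by (simp add: K0_inv)
  then have "stable_class (p \<oplus>\<^sub>m q) = stable_class zproj"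
    using pq by (simp add: K0_simps)
  then have "stably_equiv V (p \<oplus>\<^sub>m q) zproj"
    using stable_class_eq_iff[OF OP_dsum[OF pq] OP_zproj] by simp
  then have "p \<oplus>\<^sub>m q = 0\<^sub>m (m + n) (m + n)"
    using stably_zero_eq_zero[OF fin _ proj_dsum[OF mn], of 1] mn by simp
  then have "p = 0\<^sub>m m m"
    using dsum_inject(1)[OF proj_carrier[OF mn(3)] zero_carrier_mat proj_carrier[OF mn(4)] zero_carrier_mat]
    by (metis zero_dsum_zero)
  then have "x = \<one>\<^bsub>K0 V\<^esub>"
    using mn pq by (simp add: x(1) K0_one K0_simps)
  then show "x \<in> {\<one>\<^bsub>K0 V\<^esub>}" by simp
next
  fix x assume "x \<in> {\<one>\<^bsub>K0 V\<^esub>}"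
  then have "x = inv\<^bsub>K0 V\<^esub> x" "x \<in> K0_pos V"
    using K0_inv[OF OP_zproj OP_zproj] group_cone_K0_pos by (auto simp: K0_one group_cone_def)
  then show "x \<in> K0_pos V \<inter> (\<lambda>x. inv\<^bsub>K0 V\<^esub> x) ` K0_pos V" by blast
qed

end

theorem theorem4p10:
  fixes V :: "'v::ab_group_add matrix_space"
  assumes "absolute_matrix_order_unit_space V"
    and "condition_T V"
  shows "group_cone (K0 V) (K0_pos V) \<and>
    ((\<forall>n\<ge>1. finite_projection V n (unit_mat V n)) \<longrightarrow> proper_cone (K0 V) (K0_pos V)) \<and>
    generating_cone (K0 V) (K0_pos V) \<and>
    ((\<forall>n\<ge>1. finite_projection V n (unit_mat V n)) \<longrightarrow>
      ordered_abelian_group (K0 V) (K0_pos V))"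
proof -
  interpret absolute_matrix_order_unit_space_T V
    using assms
    by (simp add: absolute_matrix_order_unit_space_T_def absolute_matrix_order_unit_space_T_axioms_def)
  show ?thesis
    using group_cone_K0_pos proper_cone_K0_pos generating_cone_K0_pos
    by (simp add: ordered_abelian_group_def)
qed

end
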